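(* Let $A$ be a semilattice of groups and $G$ a group. For any admissible extension $A\overset{i}{\to}U\overset{j}{\to}G$ of $A$ by $G$ there exists a twisted partial action $\Theta$ of $G$ on $A$ such that $U$ is equivalent (as an extension of $A$ by $G$) to the crossed product $A*_\Theta G$, regarded as an extension of $A$ by $G$ via $a\mapsto a\delta_1$ and $a\delta_x\mapsto x$.
   Context: A semilattice of groups is an inverse semigroup $A$ whose idempotents are central; for $e\in E(A)$ let $A_e=\{a\in A: aa^{-1}=a^{-1}a=e\}$, so $A=\bigsqcup_{e\in E(A)}A_e$. For an inverse semigroup $S$, $\le$ is the natural partial order, $\sigma$ the minimum group congruence ($(s,t)\in\sigma$ iff $es=et$ for some $e\in E(S)$), $S$ is $E$-unitary if $e\le s$, $e\in E(S)$ imply $s\in E(S)$. An extension of $A$ by an inverse semigroup $S$ (Lausch) is an inverse semigroup $U$ with a monomorphism $i:A\to U$ and an idempotent-separating epimorphism $\pi:U\to S$ with $i(A)=\pi^{-1}(E(S))$. A transversal of $\pi$ is a map $\rho:S\to U$ with $\pi\circ\rho=\mathrm{id}_S$ and $\rho(E(S))\subseteq E(U)$; it is order-preserving if $s\le t$ implies $\rho(s)\le\rho(t)$. An extension of $A$ by a group $G$ is an inverse semigroup $U$ with a monomorphism $i:A\to U$ and an epimorphism $j:U\to G$ with $i(A)=j^{-1}(1)$. Two such extensions $(U,i,j)$, $(U',i',j')$ are equivalent if there is an isomorphism $\mu:U\to U'$ with $\mu\circ i=i'$ and $j'\circ\mu=j$. The extension is admissible if there exist an inverse semigroup $S$ and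 epimorphisms $\pi:U\to S$, $\kappa:S\to G$ such that $A\overset{i}{\to}U\overset{\pi}{\to}S$ is an extension of $A$ by $S$, $j=\kappa\circ\pi$, and $\pi$ has an order-preserving transversal. A multiplier of a semigroup $T$ is a pair $(L,R)$ of maps $T\to T$ with $L(st)=L(s)t$, $R(st)=sR(t)$, $sL(t)=R(s)t$; one writes $ws=L(s)$, $sw=R(s)$ for $w=(L,R)$. Multipliers form a monoid $\mathcal M(T)$ with $(L,R)(L',R')=(L\circ L',R'\circ R)$; $\mathcal U(\mathcal M(T))$ is its unit group. A twisted partial action of a group $G$ on a semigroup $T$ is a pair $\Theta=(\theta,w)$, where $\theta=\{\theta_x:D_{x^{-1}}\to D_x\}_{x\in G}$ are isomorphisms between nonempty ideals of $T$ and $w=\{w_{x,y}\in\mathcal U(\mathcal M(D_xD_{xy}))\}_{x,y\in G}$, such that: (i) $D_x^2=D_x$, $D_xD_y=D_yD_x$; (ii) $D_1=T$, $\theta_1=\mathrm{id}_T$; (iii) $\theta_x(D_{x^{-1}}D_y)=D_xD_{xy}$; (iv) $\theta_x(\theta_y(s))=w_{x,y}\theta_{xy}(s)w_{x,y}^{-1}$ for $s\in D_{y^{-1}}D_{y^{-1}x^{-1}}$; (v) $w_{1,x}$ and $w_{x,1}$ are the identity multiplier of $D_x$; (vi) $\theta_x(sw_{y,z})w_{x,yz}=\theta_x(s)w_{x,y}w_{xy,z}$ for $s\in D_{x^{-1}}D_yD_{yz}$. The crossed product is $T*_\Theta G=\{s\delta_x: x\in G, s\in D_x\}$ with product $s\delta_x\cdot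 t\delta_y=\theta_x(\theta_x^{-1}(s)t)w_{x,y}\delta_{xy}$ (an associative semigroup; an inverse semigroup when $T$ is inverse). *)

theory Defs
  imports "HOL-Algebra.Group"
begin

text \<open>Semigroups are represented by HOL-Algebra monoid records; the field one is ignored.\<close>

definition sgrp :: "('a, 'b) monoid_scheme \<Rightarrow> bool" where
  "sgrp S \<longleftrightarrow> (\<forall>a\<in>carrier S. \<forall>b\<in>carrier S. a \<otimes>\<^bsub>S\<^esub> b \<in> carrier S) \<and>
     (\<forall>a\<in>carrier S. \<forall>b\<in>carrier S. \<forall>c\<in>carrier S.
        (a \<otimes>\<^bsub>S\<^esub> b) \<otimes>\<^bsub>S\<^esub> c = a \<otimes>\<^bsub>S\<^esub> (b \<otimes>\<^bsub>S\<^esub> c))"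

definition inverse_semigroup :: "('a, 'b) monoid_scheme \<Rightarrow> bool" where
  "inverse_semigroup S \<longleftrightarrow> sgrp S \<and>
     (\<forall>a\<in>carrier S. \<exists>!b. b \<in> carrier S \<and> a \<otimes>\<^bsub>S\<^esub> b \<otimes>\<^bsub>S\<^esub> a = a
                              \<and> b \<otimes>\<^bsub>S\<^esub> a \<otimes>\<^bsub>S\<^esub> b = b)"

definition idems :: "('a, 'b) monoid_scheme \<Rightarrow> 'a set" where
  "idems S = {e \<in> carrier S. e \<otimes>\<^bsub>S\<^esub> e = e}"

definition nat_le :: "('a, 'b) monoid_scheme \<Rightarrow> 'a \<Rightarrow> 'a \<Rightarrow> bool" where
  "nat_le S s t \<longleftrightarrow> s \<in> carrier S \<and> t \<in> carrier S \<and> (\<exists>e\<in>idems S. s = e \<otimes>\<^bsub>S\<^esub> t)"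

definition semilattice_of_groups :: "('a, 'b) monoid_scheme \<Rightarrow> bool" where
  "semilattice_of_groups A \<longleftrightarrow> inverse_semigroup A \<and>
     (\<forall>e\<in>idems A. \<forall>a\<in>carrier A. e \<otimes>\<^bsub>A\<^esub> a = a \<otimes>\<^bsub>A\<^esub> e)"

definition sg_hom :: "('a, 'b) monoid_scheme \<Rightarrow> ('c, 'd) monoid_scheme \<Rightarrow> ('a \<Rightarrow> 'c) \<Rightarrow> bool" where
  "sg_hom S T f \<longleftrightarrow> f \<in> carrier S \<rightarrow> carrier T \<and>
     (\<forall>a\<in>carrier S. \<forall>b\<in>carrier S. f (a \<otimes>\<^bsub>S\<^esub> b) = f a \<otimes>\<^bsub>T\<^esub> f b)"

definition sg_mono :: "('a, 'b) monoid_scheme \<Rightarrow> ('c, 'd) monoid_scheme \<Rightarrow> ('a \<Rightarrow> 'c) \<Rightarrow> bool" where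
  "sg_mono S T f \<longleftrightarrow> sg_hom S T f \<and> inj_on f (carrier S)"

definition sg_epi :: "('a, 'b) monoid_scheme \<Rightarrow> ('c, 'd) monoid_scheme \<Rightarrow> ('a \<Rightarrow> 'c) \<Rightarrow> bool" where
  "sg_epi S T f \<longleftrightarrow> sg_hom S T f \<and> f ` carrier S = carrier T"

definition idem_separating :: "('a, 'b) monoid_scheme \<Rightarrow> ('a \<Rightarrow> 'c) \<Rightarrow> bool" where
  "idem_separating U p \<longleftrightarrow> (\<forall>e\<in>idems U. \<forall>f\<in>idems U. p e = p f \<longrightarrow> e = f)"

definition lausch_extension ::
  "('a, 'b) monoid_scheme \<Rightarrow> ('u, 'c) monoid_scheme \<Rightarrow> ('s, 'd) monoid_scheme
   \<Rightarrow> ('a \<Rightarrow> 'u) \<Rightarrow> ('u \<Rightarrow> 's) \<Rightarrow> bool" where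
  "lausch_extension A U S i p \<longleftrightarrow> inverse_semigroup A \<and> inverse_semigroup U \<and> inverse_semigroup S \<and>
     sg_mono A U i \<and> sg_epi U S p \<and> idem_separating U p \<and>
     i ` carrier A = {u \<in> carrier U. p u \<in> idems S}"

definition transversal :: "('u, 'c) monoid_scheme \<Rightarrow> ('s, 'd) monoid_scheme
   \<Rightarrow> ('u \<Rightarrow> 's) \<Rightarrow> ('s \<Rightarrow> 'u) \<Rightarrow> bool" where
  "transversal U S p \<rho> \<longleftrightarrow> \<rho> \<in> carrier S \<rightarrow> carrier U \<and> (\<forall>s\<in>carrier S. p (\<rho> s) = s) \<and>
     \<rho> ` idems S \<subseteq> idems U"

definition order_preserving_transversal :: "('u, 'c) monoid_scheme \<Rightarrow> ('s, 'd) monoid_scheme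
   \<Rightarrow> ('u \<Rightarrow> 's) \<Rightarrow> ('s \<Rightarrow> 'u) \<Rightarrow> bool" where
  "order_preserving_transversal U S p \<rho> \<longleftrightarrow> transversal U S p \<rho> \<and>
     (\<forall>s\<in>carrier S. \<forall>t\<in>carrier S. nat_le S s t \<longrightarrow> nat_le U (\<rho> s) (\<rho> t))"

definition group_extension ::
  "('a, 'b) monoid_scheme \<Rightarrow> ('u, 'c) monoid_scheme \<Rightarrow> ('g, 'd) monoid_scheme
   \<Rightarrow> ('a \<Rightarrow> 'u) \<Rightarrow> ('u \<Rightarrow> 'g) \<Rightarrow> bool" where
  "group_extension A U G i j \<longleftrightarrow> inverse_semigroup A \<and> inverse_semigroup U \<and> group G \<and>
     sg_mono A U i \<and> sg_epi U G j \<and> i ` carrier A = {u \<in> carrier U. j u = \<one>\<^bsub>G\<^esub>}"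

definition equivalent_ext ::
  "('a, 'b) monoid_scheme \<Rightarrow> ('u, 'c) monoid_scheme \<Rightarrow> ('a \<Rightarrow> 'u) \<Rightarrow> ('u \<Rightarrow> 'g)
   \<Rightarrow> ('v, 'e) monoid_scheme \<Rightarrow> ('a \<Rightarrow> 'v) \<Rightarrow> ('v \<Rightarrow> 'g) \<Rightarrow> bool" where
  "equivalent_ext A U i j U' i' j' \<longleftrightarrow> (\<exists>\<mu>. bij_betw \<mu> (carrier U) (carrier U') \<and> sg_hom U U' \<mu> \<and>
     (\<forall>a\<in>carrier A. \<mu> (i a) = i' a) \<and> (\<forall>u\<in>carrier U. j' (\<mu> u) = j u))"

definition admissible_via ::
  "('a, 'b) monoid_scheme \<Rightarrow> ('u, 'c) monoid_scheme \<Rightarrow> ('g, 'd) monoid_scheme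
   \<Rightarrow> ('a \<Rightarrow> 'u) \<Rightarrow> ('u \<Rightarrow> 'g) \<Rightarrow> ('s, 'e) monoid_scheme \<Rightarrow> ('u \<Rightarrow> 's) \<Rightarrow> ('s \<Rightarrow> 'g) \<Rightarrow> bool" where
  "admissible_via A U G i j S p k \<longleftrightarrow> group_extension A U G i j \<and> inverse_semigroup S \<and>
     sg_epi U S p \<and> sg_epi S G k \<and> lausch_extension A U S i p \<and>
     (\<forall>u\<in>carrier U. j u = k (p u)) \<and> (\<exists>\<rho>. order_preserving_transversal U S p \<rho>)"

definition setmult :: "('a, 'b) monoid_scheme \<Rightarrow> 'a set \<Rightarrow> 'a set \<Rightarrow> 'a set" where
  "setmult T X Y = {x \<otimes>\<^bsub>T\<^esub> y | x y. x \<in> X \<and> y \<in> Y}"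

definition sg_ideal :: "('a, 'b) monoid_scheme \<Rightarrow> 'a set \<Rightarrow> bool" where
  "sg_ideal T I \<longleftrightarrow> I \<subseteq> carrier T \<and> I \<noteq> {} \<and>
     (\<forall>a\<in>I. \<forall>t\<in>carrier T. a \<otimes>\<^bsub>T\<^esub> t \<in> I \<and> t \<otimes>\<^bsub>T\<^esub> a \<in> I)"

text \<open>A multiplier of the subsemigroup X of T is a pair (L,R); w s = L s, s w = R s.
  Maps are only relevant on X.\<close>
definition is_multiplier :: "('a, 'b) monoid_scheme \<Rightarrow> 'a set \<Rightarrow> ('a \<Rightarrow> 'a) \<times> ('a \<Rightarrow> 'a) \<Rightarrow> bool" where
  "is_multiplier T X w \<longleftrightarrow> fst w \<in> X \<rightarrow> X \<and> snd w \<in> X \<rightarrow> X \<and>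
     (\<forall>s\<in>X. \<forall>t\<in>X. fst w (s \<otimes>\<^bsub>T\<^esub> t) = fst w s \<otimes>\<^bsub>T\<^esub> t \<and>
                    snd w (s \<otimes>\<^bsub>T\<^esub> t) = s \<otimes>\<^bsub>T\<^esub> snd w t \<and>
                    s \<otimes>\<^bsub>T\<^esub> fst w t = snd w s \<otimes>\<^bsub>T\<^esub> t)"

text \<open>Invertible multipliers (units of the multiplier monoid, product (L,R)(L',R') = (L o L', R' o R)).\<close>
definition unit_multiplier :: "('a, 'b) monoid_scheme \<Rightarrow> 'a set \<Rightarrow> ('a \<Rightarrow> 'a) \<times> ('a \<Rightarrow> 'a) \<Rightarrow> bool" where
  "unit_multiplier T X w \<longleftrightarrow> is_multiplier T X w \<and>
     (\<exists>w'. is_multiplier T X w' \<and>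
        (\<forall>s\<in>X. fst w (fst w' s) = s \<and> fst w' (fst w s) = s \<and>
               snd w (snd w' s) = s \<and> snd w' (snd w s) = s))"

definition mult_inv :: "'a set \<Rightarrow> ('a \<Rightarrow> 'a) \<times> ('a \<Rightarrow> 'a) \<Rightarrow> ('a \<Rightarrow> 'a) \<times> ('a \<Rightarrow> 'a)" where
  "mult_inv X w = (inv_into X (fst w), inv_into X (snd w))"

definition twisted_partial_action ::
  "('g, 'c) monoid_scheme \<Rightarrow> ('a, 'b) monoid_scheme \<Rightarrow> ('g \<Rightarrow> 'a set) \<Rightarrow> ('g \<Rightarrow> 'a \<Rightarrow> 'a)
   \<Rightarrow> ('g \<Rightarrow> 'g \<Rightarrow> ('a \<Rightarrow> 'a) \<times> ('a \<Rightarrow> 'a)) \<Rightarrow> bool" where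
  "twisted_partial_action G T D \<theta> w \<longleftrightarrow> group G \<and> sgrp T \<and>
     \<comment> \<open>theta_x : D_{x^-1} \<rightarrow> D_x isomorphisms between nonempty ideals\<close>
     (\<forall>x\<in>carrier G. sg_ideal T (D x) \<and> bij_betw (\<theta> x) (D (inv\<^bsub>G\<^esub> x)) (D x) \<and>
        (\<forall>a\<in>D (inv\<^bsub>G\<^esub> x). \<forall>b\<in>D (inv\<^bsub>G\<^esub> x). \<theta> x (a \<otimes>\<^bsub>T\<^esub> b) = \<theta> x a \<otimes>\<^bsub>T\<^esub> \<theta> x b)) \<and>
     \<comment> \<open>w_{x,y} is a unit multiplier of D_x D_{xy}\<close>
     (\<forall>x\<in>carrier G. \<forall>y\<in>carrier G.
        unit_multiplier T (setmult T (D x) (D (x \<otimes>\<^bsub>G\<^esub> y))) (w x y)) \<and>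
     \<comment> \<open>(i)\<close>
     (\<forall>x\<in>carrier G. setmult T (D x) (D x) = D x) \<and>
     (\<forall>x\<in>carrier G. \<forall>y\<in>carrier G. setmult T (D x) (D y) = setmult T (D y) (D x)) \<and>
     \<comment> \<open>(ii)\<close>
     D \<one>\<^bsub>G\<^esub> = carrier T \<and> (\<forall>s\<in>carrier T. \<theta> \<one>\<^bsub>G\<^esub> s = s) \<and>
     \<comment> \<open>(iii)\<close>
     (\<forall>x\<in>carrier G. \<forall>y\<in>carrier G.
        \<theta> x ` setmult T (D (inv\<^bsub>G\<^esub> x)) (D y) = setmult T (D x) (D (x \<otimes>\<^bsub>G\<^esub> y))) \<and>
     \<comment> \<open>(iv): theta_x(theta_y(s)) = (w_{x,y} theta_{xy}(s)) w_{x,y}^-1\<close>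
     (\<forall>x\<in>carrier G. \<forall>y\<in>carrier G.
        \<forall>s\<in>setmult T (D (inv\<^bsub>G\<^esub> y)) (D (inv\<^bsub>G\<^esub> y \<otimes>\<^bsub>G\<^esub> inv\<^bsub>G\<^esub> x)).
          \<theta> x (\<theta> y s) =
            snd (mult_inv (setmult T (D x) (D (x \<otimes>\<^bsub>G\<^esub> y))) (w x y))
                (fst (w x y) (\<theta> (x \<otimes>\<^bsub>G\<^esub> y) s))) \<and>
     \<comment> \<open>(v)\<close>
     (\<forall>x\<in>carrier G. \<forall>s\<in>D x.
        fst (w \<one>\<^bsub>G\<^esub> x) s = s \<and> snd (w \<one>\<^bsub>G\<^esub> x) s = s \<and>
        fst (w x \<one>\<^bsub>G\<^esub>) s = s \<and> snd (w x \<one>\<^bsub>G\<^esub>) s = s) \<and>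
     \<comment> \<open>(vi): theta_x(s w_{y,z}) w_{x,yz} = (theta_x(s) w_{x,y}) w_{xy,z}\<close>
     (\<forall>x\<in>carrier G. \<forall>y\<in>carrier G. \<forall>z\<in>carrier G.
        \<forall>s\<in>setmult T (setmult T (D (inv\<^bsub>G\<^esub> x)) (D y)) (D (y \<otimes>\<^bsub>G\<^esub> z)).
          snd (w x (y \<otimes>\<^bsub>G\<^esub> z)) (\<theta> x (snd (w y z) s)) =
          snd (w (x \<otimes>\<^bsub>G\<^esub> y) z) (snd (w x y) (\<theta> x s)))"

text \<open>Crossed product T *_Theta G; the element s delta_x is the pair (s, x).\<close>
definition crossed_product ::
  "('a, 'b) monoid_scheme \<Rightarrow> ('g, 'c) monoid_scheme \<Rightarrow> ('g \<Rightarrow> 'a set) \<Rightarrow> ('g \<Rightarrow> 'a \<Rightarrow> 'a)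
   \<Rightarrow> ('g \<Rightarrow> 'g \<Rightarrow> ('a \<Rightarrow> 'a) \<times> ('a \<Rightarrow> 'a)) \<Rightarrow> ('a \<times> 'g) monoid" where
  "crossed_product T G D \<theta> w =
     \<lparr> carrier = {(s, x). x \<in> carrier G \<and> s \<in> D x},
       mult = (\<lambda>(s, x) (t, y).
                 (snd (w x y) (\<theta> x (inv_into (D (inv\<^bsub>G\<^esub> x)) (\<theta> x) s \<otimes>\<^bsub>T\<^esub> t)), x \<otimes>\<^bsub>G\<^esub> y)),
       one = undefined \<rparr>"

end

theory Submission
  imports Defs
begin

text \<open>
  Write \<open>N = i(A) = j\<^sup>-\<^sup>1(1)\<close>, where idempotents are central, and \<open>\<tau> = \<rho> \<circ> \<pi>\<close> for an
  order-preserving transversal \<open>\<rho>\<close>. Since \<open>\<pi>\<close> separates idempotents, \<open>\<tau>(u)\<close> has the same range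
  idempotent as \<open>u\<close>, and order preservation gives \<open>\<tau>(au) = aa\<^sup>\<star> \<tau>(u)\<close> for \<open>a \<in> N\<close>; moreover \<open>\<tau>(u)\<close>
  depends only on \<open>j(u)\<close> and \<open>uu\<^sup>\<star>\<close>. So for each \<open>x \<in> G\<close> the elements \<open>\<tau>(u)\<close>, \<open>j(u) = x\<close>, form a
  family of pairwise compatible elements indexed by idempotents, which behaves like a single
  (partially defined) element \<open>\<gamma>\<^sub>x\<close> of \<open>U\<close>, and every \<open>u\<close> is uniquely \<open>a \<gamma>\<^sub>x\<close> with
  \<open>a = u \<tau>(u)\<^sup>\<star> \<in> N\<close>. As for group extensions, \<open>\<theta>\<^sub>x\<close> is conjugation by \<open>\<gamma>\<^sub>x\<close> and \<open>w\<^sub>x\<^sub>,\<^sub>y\<close> is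
  multiplication by \<open>\<gamma>\<^sub>x \<gamma>\<^sub>y \<gamma>\<^sub>x\<^sub>y\<^sup>\<star>\<close>, evaluated at the range idempotent of the argument.
\<close>

section \<open>Inverse semigroups\<close>

text \<open>The obstacle is that \<open>\<gamma>\<^sub>x\<close> can only be evaluated at an
  idempotent, and the right idempotent changes from factor to factor. What tames this is a rigidity:
  among elements over the same member of \<open>G\<close>, the range idempotent determines the
  domain idempotent and conversely, because idempotents commute with \<open>N\<close>. Hence in a
  product of several \<open>\<gamma>\<close> the representatives can be chosen so that each domain
  is the next range; the idempotents in between are absorbed, and every identity reduces to the one
  known for group extensions.

  Two economies shape the rest. The quotient \<open>S\<close> enters only when the transversal is
  shown to satisfy the assumptions of the locale \<open>tau_ext\<close>; the calculations take place
  in \<open>U\<close> and are pulled back to \<open>A\<close> along \<open>i\<close>. And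
  associativity of the crossed product is never calculated: the map
  \<open>u \<mapsto> (a, x)\<close> is shown to be a multiplicative bijection, and the inverse
  semigroup structure is then transported from \<open>U\<close>.\<close>

definition sg_inv :: "('a, 'b) monoid_scheme \<Rightarrow> 'a \<Rightarrow> 'a" where
  "sg_inv S a = (THE b. b \<in> carrier S \<and> a \<otimes>\<^bsub>S\<^esub> b \<otimes>\<^bsub>S\<^esub> a = a \<and> b \<otimes>\<^bsub>S\<^esub> a \<otimes>\<^bsub>S\<^esub> b = b)"

locale inv_sgrp =
  fixes U :: "('u, 'b) monoid_scheme" (structure)
  assumes inverse_semigroup: "inverse_semigroup U"
begin

abbreviation star :: "'u \<Rightarrow> 'u" (\<open>_\<^sup>\<star>\<close> [1000] 1000) where
  "u\<^sup>\<star> \<equiv> sg_inv U u"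

lemma m_closed [simp]: "a \<in> carrier U \<Longrightarrow> b \<in> carrier U \<Longrightarrow> a \<otimes> b \<in> carrier U"
  using inverse_semigroup by (simp add: inverse_semigroup_def sgrp_def)

lemma m_assoc [simp]:
  "a \<in> carrier U \<Longrightarrow> b \<in> carrier U \<Longrightarrow> c \<in> carrier U \<Longrightarrow> (a \<otimes> b) \<otimes> c = a \<otimes> (b \<otimes> c)"
  using inverse_semigroup by (simp add: inverse_semigroup_def sgrp_def)

lemma mult_eq_mult_assoc:
  "a \<otimes> b = c \<otimes> d \<Longrightarrow> a \<in> carrier U \<Longrightarrow> b \<in> carrier U \<Longrightarrow> c \<in> carrier U \<Longrightarrow> d \<in> carrier U \<Longrightarrow>
   z \<in> carrier U \<Longrightarrow> a \<otimes> (b \<otimes> z) = c \<otimes> (d \<otimes> z)"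
  by (metis m_assoc)

lemma mult_eq_assoc:
  "a \<otimes> b = c \<Longrightarrow> a \<in> carrier U \<Longrightarrow> b \<in> carrier U \<Longrightarrow> z \<in> carrier U \<Longrightarrow> a \<otimes> (b \<otimes> z) = c \<otimes> z"
  by (metis m_assoc)

lemma star_prop:
  assumes "a \<in> carrier U"
  shows "a\<^sup>\<star> \<in> carrier U \<and> a \<otimes> a\<^sup>\<star> \<otimes> a = a \<and> a\<^sup>\<star> \<otimes> a \<otimes> a\<^sup>\<star> = a\<^sup>\<star>"
  using theI'[of "\<lambda>b. b \<in> carrier U \<and> a \<otimes> b \<otimes> a = a \<and> b \<otimes> a \<otimes> b = b"]
    inverse_semigroup assms unfolding sg_inv_def inverse_semigroup_def by blast

lemma star_closed [simp]: "a \<in> carrier U \<Longrightarrow> a\<^sup>\<star> \<in> carrier U"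
  using star_prop by blast

lemma m_star_m [simp]:
  assumes "a \<in> carrier U"
  shows "a \<otimes> (a\<^sup>\<star> \<otimes> a) = a" "a\<^sup>\<star> \<otimes> (a \<otimes> a\<^sup>\<star>) = a\<^sup>\<star>"
  using star_prop[OF assms] assms by simp_all

lemma m_star_m_assoc [simp]:
  assumes "a \<in> carrier U" "z \<in> carrier U"
  shows "a \<otimes> (a\<^sup>\<star> \<otimes> (a \<otimes> z)) = a \<otimes> z" "a\<^sup>\<star> \<otimes> (a \<otimes> (a\<^sup>\<star> \<otimes> z)) = a\<^sup>\<star> \<otimes> z"
  using m_star_m[OF assms(1)] m_assoc[of a "a\<^sup>\<star> \<otimes> a" z] m_assoc[of "a\<^sup>\<star>" "a \<otimes> a\<^sup>\<star>" z] assms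
  by simp_all

lemma star_unique:
  assumes "a \<in> carrier U" "b \<in> carrier U" "a \<otimes> (b \<otimes> a) = a" "b \<otimes> (a \<otimes> b) = b"
  shows "a\<^sup>\<star> = b"
proof -
  have "\<exists>!b. b \<in> carrier U \<and> a \<otimes> b \<otimes> a = a \<and> b \<otimes> a \<otimes> b = b"
    using inverse_semigroup assms(1) by (simp add: inverse_semigroup_def)
  then show ?thesis
    using star_prop[OF assms(1)] assms by (metis m_assoc)
qed

lemma star_star [simp]: "a \<in> carrier U \<Longrightarrow> a\<^sup>\<star>\<^sup>\<star> = a"
  by (rule star_unique) simp_all

lemma idemsI: "e \<in> carrier U \<Longrightarrow> e \<otimes> e = e \<Longrightarrow> e \<in> idems U"
  by (simp add: idems_def)

lemma idems_closed [simp]: "e \<in> idems U \<Longrightarrow> e \<in> carrier U"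
  by (simp add: idems_def)

lemma idem [simp]: "e \<in> idems U \<Longrightarrow> e \<otimes> e = e"
  unfolding idems_def by blast

lemma idem_assoc [simp]: "e \<in> idems U \<Longrightarrow> z \<in> carrier U \<Longrightarrow> e \<otimes> (e \<otimes> z) = e \<otimes> z"
  by (metis idem idems_closed m_assoc)

lemma star_idem [simp]: "e \<in> idems U \<Longrightarrow> e\<^sup>\<star> = e"
  by (rule star_unique) simp_all

lemma range_idem [simp]: "a \<in> carrier U \<Longrightarrow> a \<otimes> a\<^sup>\<star> \<in> idems U"
  and domain_idem [simp]: "a \<in> carrier U \<Longrightarrow> a\<^sup>\<star> \<otimes> a \<in> idems U"
  by (rule idemsI; simp)+

text \<open>If \<open>x\<close> is the inverse of \<open>e f\<close>, then \<open>f x e\<close> is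
  an inverse too, so uniqueness gives \<open>x = f x e\<close>. That form makes \<open>x\<close>
  idempotent, and an idempotent is its own inverse, so \<open>e f = x\<close>.\<close>

lemma idem_mult_idem:
  assumes e: "e \<in> idems U" and f: "f \<in> idems U"
  shows "e \<otimes> f \<in> idems U"
proof -
  define x where "x = (e \<otimes> f)\<^sup>\<star>"
  have cc [simp]: "e \<in> carrier U" "f \<in> carrier U" "x \<in> carrier U"
    using e f by (simp_all add: x_def)
  have m1: "e \<otimes> (f \<otimes> (x \<otimes> (e \<otimes> f))) = e \<otimes> f"
    using m_star_m(1)[of "e \<otimes> f"] by (simp flip: x_def)
  have m2: "x \<otimes> (e \<otimes> (f \<otimes> x)) = x"
    using m_star_m(2)[of "e \<otimes> f"] by (simp flip: x_def)
  have two: "x \<otimes> (e \<otimes> (f \<otimes> (x \<otimes> z))) = x \<otimes> z" if "z \<in> carrier U" for z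
    using arg_cong[OF m2, of "\<lambda>v. v \<otimes> z"] that by simp
  have x: "x = f \<otimes> (x \<otimes> e)"
    unfolding x_def by (rule star_unique) (use e f m1 two in \<open>simp_all flip: x_def\<close>)
  have "f \<otimes> (x \<otimes> e) \<otimes> (f \<otimes> (x \<otimes> e)) = f \<otimes> (x \<otimes> e)"
    using two by simp
  then have xi: "x \<in> idems U"
    using x by (intro idemsI) simp_all
  have "e \<otimes> f = x\<^sup>\<star>"
    by (simp add: x_def)
  then show ?thesis
    using xi by simp
qed

text \<open>Since \<open>e f\<close> and \<open>f e\<close> are both idempotent, \<open>f e\<close>
  is an inverse of \<open>e f\<close>; but the idempotent \<open>e f\<close> is its own
  inverse.\<close>

lemma idem_comm:
  assumes e: "e \<in> idems U" and f: "f \<in> idems U"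
  shows "e \<otimes> f = f \<otimes> e"
proof -
  have "(e \<otimes> f) \<otimes> (e \<otimes> f) = e \<otimes> f" "(f \<otimes> e) \<otimes> (f \<otimes> e) = f \<otimes> e"
    using idem_mult_idem e f by (blast intro: idem)+
  then have "(e \<otimes> f)\<^sup>\<star> = f \<otimes> e"
    by (intro star_unique) (use e f in simp_all)
  then show ?thesis
    using star_idem[OF idem_mult_idem[OF e f]] by simp
qed

lemma idem_left_comm:
  "e \<in> idems U \<Longrightarrow> f \<in> idems U \<Longrightarrow> z \<in> carrier U \<Longrightarrow> e \<otimes> (f \<otimes> z) = f \<otimes> (e \<otimes> z)"
  by (metis idem_comm idems_closed m_assoc)

lemma idem_sandwich:
  "e \<in> idems U \<Longrightarrow> f \<in> idems U \<Longrightarrow> e \<otimes> (f \<otimes> e) = f \<otimes> (e \<otimes> f)"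
  by (metis idem_assoc idem_comm idems_closed)

text \<open>In both inverse equations the idempotents \<open>b b\<^sup>\<star>\<close> and
  \<open>a\<^sup>\<star> a\<close> stand side by side; once swapped, each is absorbed by its
  neighbours.\<close>

lemma star_mult [simp]:
  assumes a [simp]: "a \<in> carrier U" and b [simp]: "b \<in> carrier U"
  shows "(a \<otimes> b)\<^sup>\<star> = b\<^sup>\<star> \<otimes> a\<^sup>\<star>"
proof (rule star_unique)
  have *: "(b \<otimes> b\<^sup>\<star>) \<otimes> (a\<^sup>\<star> \<otimes> a) = (a\<^sup>\<star> \<otimes> a) \<otimes> (b \<otimes> b\<^sup>\<star>)"
    by (rule idem_comm) simp_all
  have "a \<otimes> ((b \<otimes> b\<^sup>\<star>) \<otimes> (a\<^sup>\<star> \<otimes> a)) \<otimes> b = a \<otimes> b"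
    unfolding * by simp
  then show "a \<otimes> b \<otimes> (b\<^sup>\<star> \<otimes> a\<^sup>\<star> \<otimes> (a \<otimes> b)) = a \<otimes> b"
    by simp
  have "b\<^sup>\<star> \<otimes> ((a\<^sup>\<star> \<otimes> a) \<otimes> (b \<otimes> b\<^sup>\<star>)) \<otimes> a\<^sup>\<star> = b\<^sup>\<star> \<otimes> a\<^sup>\<star>"
    unfolding *[symmetric] by simp
  then show "b\<^sup>\<star> \<otimes> a\<^sup>\<star> \<otimes> (a \<otimes> b \<otimes> (b\<^sup>\<star> \<otimes> a\<^sup>\<star>)) = b\<^sup>\<star> \<otimes> a\<^sup>\<star>"
    by simp
qed simp_all

lemma conj_idem [simp]:
  assumes "a \<in> carrier U" "e \<in> idems U"
  shows "a \<otimes> (e \<otimes> a\<^sup>\<star>) \<in> idems U"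
  using range_idem[of "a \<otimes> e"] assms by simp

text \<open>Read with the left-hand side as \<open>(a e a\<^sup>\<star>) a\<close>, this moves an
  idempotent from the right of \<open>a\<close> to its left.\<close>

lemma conj_idem_mult:
  assumes a [simp]: "a \<in> carrier U" and e [simp]: "e \<in> idems U"
  shows "a \<otimes> (e \<otimes> (a\<^sup>\<star> \<otimes> a)) = a \<otimes> e"
proof -
  have "e \<otimes> (a\<^sup>\<star> \<otimes> a) = (a\<^sup>\<star> \<otimes> a) \<otimes> e"
    by (rule idem_comm) simp_all
  then show ?thesis
    by simp
qed

end

section \<open>Homomorphisms and isomorphisms of inverse semigroups\<close>

lemma sg_hom_star:
  assumes "inverse_semigroup S" "inverse_semigroup T" "sg_hom S T f" "a \<in> carrier S"
  shows "f (sg_inv S a) = sg_inv T (f a)"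
proof -
  interpret S: inv_sgrp S by (rule inv_sgrp.intro) fact
  interpret T: inv_sgrp T by (rule inv_sgrp.intro) fact
  have c: "f b \<in> carrier T" if "b \<in> carrier S" for b
    using assms(3) that by (auto simp: sg_hom_def)
  have h: "f (b \<otimes>\<^bsub>S\<^esub> c) = f b \<otimes>\<^bsub>T\<^esub> f c" if "b \<in> carrier S" "c \<in> carrier S" for b c
    using assms(3) that by (auto simp: sg_hom_def)
  show ?thesis
    by (rule T.star_unique[symmetric]) (use assms(4) c in \<open>simp_all flip: h\<close>)
qed

text \<open>Serves to make the crossed product an inverse semigroup by transport, in place of a
  direct check of associativity and inverses.\<close>

lemma inverse_semigroup_iso:
  assumes U: "inverse_semigroup U" and bij: "bij_betw f (carrier U) (carrier V)" and hom: "sg_hom U V f"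
  shows "inverse_semigroup V"
proof -
  interpret inv_sgrp U by (rule inv_sgrp.intro) fact
  have h: "f b \<otimes>\<^bsub>V\<^esub> f c = f (b \<otimes>\<^bsub>U\<^esub> c)" if "b \<in> carrier U" "c \<in> carrier U" for b c
    using hom that by (auto simp: sg_hom_def)
  have im: "carrier V = f ` carrier U"
    using bij by (simp add: bij_betw_def)
  have inj: "f b = f c \<longleftrightarrow> b = c" if "b \<in> carrier U" "c \<in> carrier U" for b c
    using bij that by (auto simp: bij_betw_def inj_on_eq_iff)
  have "\<exists>!b. b \<in> carrier V \<and> f a \<otimes>\<^bsub>V\<^esub> b \<otimes>\<^bsub>V\<^esub> f a = f a \<and> b \<otimes>\<^bsub>V\<^esub> f a \<otimes>\<^bsub>V\<^esub> b = b"
    if a: "a \<in> carrier U" for a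
    by (rule ex1I[of _ "f (sg_inv U a)"]) (use a in \<open>auto simp: im h inj star_unique\<close>)
  then show ?thesis
    unfolding inverse_semigroup_def sgrp_def im by (auto simp: h)
qed

section \<open>Compatible representatives of the classes of an extension\<close>

text \<open>The assumptions record what is left of \<open>\<rho> \<circ> p\<close> once the quotient
  \<open>S\<close> is forgotten: \<open>\<tau>_range\<close> comes from \<open>p\<close> separating
  idempotents, \<open>\<tau>_mult\<close> from order preservation. Centrality concerns the kernel of
  \<open>j\<close>, the copy of \<open>A\<close> in \<open>U\<close>.\<close>

locale tau_ext = inv_sgrp U + G: group G
  for U :: "('u, 'b) monoid_scheme" (structure) and G :: "('g, 'c) monoid_scheme" +
  fixes j :: "'u \<Rightarrow> 'g" and \<tau> :: "'u \<Rightarrow> 'u"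
  assumes j_epi: "sg_epi U G j"
    and idem_central: "\<And>e a. e \<in> idems U \<Longrightarrow> a \<in> carrier U \<Longrightarrow> j a = \<one>\<^bsub>G\<^esub> \<Longrightarrow> e \<otimes> a = a \<otimes> e"
    and \<tau>_closed [simp]: "\<And>u. u \<in> carrier U \<Longrightarrow> \<tau> u \<in> carrier U"
    and j_\<tau> [simp]: "\<And>u. u \<in> carrier U \<Longrightarrow> j (\<tau> u) = j u"
    and \<tau>_range: "\<And>u. u \<in> carrier U \<Longrightarrow> \<tau> u \<otimes> (\<tau> u)\<^sup>\<star> = u \<otimes> u\<^sup>\<star>"
    and \<tau>_mult: "\<And>a u. a \<in> carrier U \<Longrightarrow> u \<in> carrier U \<Longrightarrow> j a = \<one>\<^bsub>G\<^esub> \<Longrightarrow>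
          \<tau> (a \<otimes> u) = a \<otimes> a\<^sup>\<star> \<otimes> \<tau> u"
    and \<tau>_idem: "\<And>e. e \<in> idems U \<Longrightarrow> \<tau> e = e"
begin

lemma j_closed [simp]: "u \<in> carrier U \<Longrightarrow> j u \<in> carrier G"
  using j_epi by (auto simp: sg_epi_def sg_hom_def)

lemma j_mult [simp]: "u \<in> carrier U \<Longrightarrow> v \<in> carrier U \<Longrightarrow> j (u \<otimes> v) = j u \<otimes>\<^bsub>G\<^esub> j v"
  using j_epi by (auto simp: sg_epi_def sg_hom_def)

lemma j_idem [simp]:
  assumes "e \<in> idems U"
  shows "j e = \<one>\<^bsub>G\<^esub>"
  using assms j_mult[of e e] by (simp add: G.r_cancel_one)

lemma j_star [simp]:
  assumes "u \<in> carrier U"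
  shows "j (u\<^sup>\<star>) = inv\<^bsub>G\<^esub> (j u)"
proof -
  have "j u \<otimes>\<^bsub>G\<^esub> j (u\<^sup>\<star>) = \<one>\<^bsub>G\<^esub>"
    using j_idem[OF range_idem[OF assms]] assms by (simp del: j_idem)
  then show ?thesis
    by (metis G.inv_equality G.inv_inv assms j_closed star_closed)
qed

text \<open>Commuting \<open>a\<^sup>\<star> a\<close> past \<open>a\<close> shows that it is a left
  identity of \<open>a\<close>, so the range lies below the domain; the same argument for
  \<open>a a\<^sup>\<star>\<close> and \<open>a\<^sup>\<star>\<close> gives the converse.\<close>

lemma kernel_range_eq_domain:
  assumes a [simp]: "a \<in> carrier U" and "j a = \<one>\<^bsub>G\<^esub>"
  shows "a\<^sup>\<star> \<otimes> a = a \<otimes> a\<^sup>\<star>"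
proof -
  have 1: "a\<^sup>\<star> \<otimes> a \<otimes> a = a"
    using idem_central[of "a\<^sup>\<star> \<otimes> a" a] assms by simp
  have 2: "a \<otimes> a\<^sup>\<star> \<otimes> a\<^sup>\<star> = a\<^sup>\<star>"
    using idem_central[of "a \<otimes> a\<^sup>\<star>" "a\<^sup>\<star>"] assms by simp
  have "a \<otimes> a\<^sup>\<star> = (a\<^sup>\<star> \<otimes> a) \<otimes> (a \<otimes> a\<^sup>\<star>)"
    using arg_cong[OF 1, of "\<lambda>v. v \<otimes> a\<^sup>\<star>"] by simp
  also have "\<dots> = (a \<otimes> a\<^sup>\<star>) \<otimes> (a\<^sup>\<star> \<otimes> a)"
    by (rule idem_comm) simp_all
  also have "\<dots> = a\<^sup>\<star> \<otimes> a"
    using arg_cong[OF 2, of "\<lambda>v. v \<otimes> a"] by simp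
  finally show ?thesis ..
qed

lemma kernel_range_mult:
  assumes [simp]: "a \<in> carrier U" "b \<in> carrier U" and j: "j a = \<one>\<^bsub>G\<^esub>"
  shows "a \<otimes> b \<otimes> (a \<otimes> b)\<^sup>\<star> = (a \<otimes> a\<^sup>\<star>) \<otimes> (b \<otimes> b\<^sup>\<star>)"
proof -
  have "a \<otimes> b \<otimes> (a \<otimes> b)\<^sup>\<star> = a \<otimes> ((b \<otimes> b\<^sup>\<star>) \<otimes> a\<^sup>\<star>)"
    by simp
  also have "(b \<otimes> b\<^sup>\<star>) \<otimes> a\<^sup>\<star> = a\<^sup>\<star> \<otimes> (b \<otimes> b\<^sup>\<star>)"
    by (rule idem_central) (use j in simp_all)
  finally show ?thesis
    by simp
qed

text \<open>When the ranges agree, the kernel element \<open>u\<^sup>\<star> v\<close> has range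
  \<open>u\<^sup>\<star> u\<close> and domain \<open>v\<^sup>\<star> v\<close>, and in the kernel
  these coincide. This is the rigidity that lets representatives be matched from either
  side.\<close>

lemma range_eq_imp_domain_eq:
  assumes [simp]: "u \<in> carrier U" "v \<in> carrier U"
    and j: "j u = j v" and r: "u \<otimes> u\<^sup>\<star> = v \<otimes> v\<^sup>\<star>"
  shows "u\<^sup>\<star> \<otimes> u = v\<^sup>\<star> \<otimes> v"
proof -
  define a where "a = u\<^sup>\<star> \<otimes> v"
  have [simp]: "a \<in> carrier U"
    by (simp add: a_def)
  have ra: "v \<otimes> (v\<^sup>\<star> \<otimes> z) = u \<otimes> (u\<^sup>\<star> \<otimes> z)" if "z \<in> carrier U" for z
    using arg_cong[OF r, of "\<lambda>w. w \<otimes> z"] that by simp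
  have "j a = \<one>\<^bsub>G\<^esub>"
    using j by (simp add: a_def)
  then have "a\<^sup>\<star> \<otimes> a = a \<otimes> a\<^sup>\<star>"
    by (simp add: kernel_range_eq_domain)
  moreover have "a\<^sup>\<star> \<otimes> a = v\<^sup>\<star> \<otimes> v"
    by (simp add: a_def flip: ra)
  moreover have "a \<otimes> a\<^sup>\<star> = u\<^sup>\<star> \<otimes> u"
    by (simp add: a_def ra)
  ultimately show ?thesis
    by simp
qed

lemma domain_eq_imp_range_eq:
  assumes "u \<in> carrier U" "v \<in> carrier U" "j u = j v" "u\<^sup>\<star> \<otimes> u = v\<^sup>\<star> \<otimes> v"
  shows "u \<otimes> u\<^sup>\<star> = v \<otimes> v\<^sup>\<star>"
  using range_eq_imp_domain_eq[of "u\<^sup>\<star>" "v\<^sup>\<star>"] assms by simp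

text \<open>\<open>v\<close> is the multiple \<open>(v u\<^sup>\<star>) u\<close> of
  \<open>u\<close> by a kernel element, so \<open>\<tau>_mult\<close> gives \<open>\<tau> v\<close>
  as an idempotent times \<open>\<tau> u\<close>, and that idempotent is the range of
  \<open>\<tau> u\<close>.\<close>

lemma \<tau>_cong:
  assumes [simp]: "u \<in> carrier U" "v \<in> carrier U"
    and j: "j u = j v" and r: "u \<otimes> u\<^sup>\<star> = v \<otimes> v\<^sup>\<star>"
  shows "\<tau> u = \<tau> v"
proof -
  define a where "a = v \<otimes> u\<^sup>\<star>"
  note d = range_eq_imp_domain_eq[OF assms]
  have [simp]: "a \<in> carrier U" "j a = \<one>\<^bsub>G\<^esub>"
    using j by (simp_all add: a_def)
  have "v = a \<otimes> u"
    by (simp add: a_def d)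
  then have "\<tau> v = a \<otimes> a\<^sup>\<star> \<otimes> \<tau> u"
    by (simp add: \<tau>_mult)
  also have "a \<otimes> a\<^sup>\<star> = v \<otimes> (u\<^sup>\<star> \<otimes> u) \<otimes> v\<^sup>\<star>"
    by (simp add: a_def)
  also have "\<dots> = \<tau> u \<otimes> (\<tau> u)\<^sup>\<star>"
    by (simp add: d \<tau>_range flip: r)
  finally show ?thesis
    by simp
qed

section \<open>Representatives selected by their range or domain idempotent\<close>

definition ranges :: "'g \<Rightarrow> 'u set" where
  "ranges x = {u \<otimes> u\<^sup>\<star> | u. u \<in> carrier U \<and> j u = x}"

text \<open>The restrictions of the virtual element \<open>\<gamma>\<^sub>x\<close> to the
  idempotents in \<open>ranges x\<close>.\<close>

definition reps :: "'g \<Rightarrow> 'u set" where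
  "reps x = {\<tau> u | u. u \<in> carrier U \<and> j u = x}"

lemma reps_closed [simp]: "r \<in> reps x \<Longrightarrow> r \<in> carrier U"
  unfolding reps_def by auto

lemma j_reps: "r \<in> reps x \<Longrightarrow> j r = x"
  unfolding reps_def by auto

lemma \<tau>_reps: "u \<in> carrier U \<Longrightarrow> j u = x \<Longrightarrow> \<tau> u \<in> reps x"
  unfolding reps_def by auto

lemma \<tau>_of_reps: "r \<in> reps x \<Longrightarrow> \<tau> r = r"
  unfolding reps_def using \<tau>_cong[OF \<tau>_closed _ j_\<tau> \<tau>_range] by blast

lemma reps_unique:
  assumes "r \<in> reps x" "s \<in> reps x" "r \<otimes> r\<^sup>\<star> = s \<otimes> s\<^sup>\<star>"
  shows "r = s"
  using \<tau>_cong[of r s] \<tau>_of_reps assms by (metis j_reps reps_closed)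

lemma reps_unique_domain:
  assumes "r \<in> reps x" "s \<in> reps x" "r\<^sup>\<star> \<otimes> r = s\<^sup>\<star> \<otimes> s"
  shows "r = s"
  using reps_unique domain_eq_imp_range_eq assms by (metis j_reps reps_closed)

text \<open>By \<open>\<tau>_mult\<close> with an idempotent factor, a representative may be cut
  down without leaving the selected family: \<open>reps x\<close> is closed downwards in the natural
  order.\<close>

lemma reps_idem_mult:
  assumes "r \<in> reps x" "e \<in> idems U"
  shows "e \<otimes> r \<in> reps x"
proof -
  have "\<tau> (e \<otimes> r) = e \<otimes> r"
    using assms by (simp add: \<tau>_mult \<tau>_of_reps[OF assms(1)])
  then show ?thesis
    using \<tau>_reps[of "e \<otimes> r" x] j_reps[OF assms(1)] assms G.l_one j_closed[of r] by simp
qed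

lemma reps_mult_idem:
  assumes "r \<in> reps x" "e \<in> idems U"
  shows "r \<otimes> e \<in> reps x"
  using reps_idem_mult[OF assms(1), of "r \<otimes> (e \<otimes> r\<^sup>\<star>)"] assms conj_idem_mult[of r e] by simp

text \<open>For \<open>u\<close> in the kernel, \<open>\<tau> u\<close> equals \<open>\<tau>\<close>
  of the idempotent \<open>u u\<^sup>\<star>\<close>, which \<open>\<tau>\<close> fixes. So the
  virtual element over the identity of \<open>G\<close> is an identity.\<close>

lemma reps_one: "reps \<one>\<^bsub>G\<^esub> = idems U"
proof
  show "idems U \<subseteq> reps \<one>\<^bsub>G\<^esub>"
    using \<tau>_reps[of _ "\<one>\<^bsub>G\<^esub>"] \<tau>_idem by (metis idems_closed j_idem subsetI)
  have "\<tau> u \<in> idems U" if "u \<in> carrier U" "j u = \<one>\<^bsub>G\<^esub>" for u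
    using \<tau>_cong[of u "u \<otimes> u\<^sup>\<star>"] \<tau>_idem[of "u \<otimes> u\<^sup>\<star>"] that by simp
  then show "reps \<one>\<^bsub>G\<^esub> \<subseteq> idems U"
    unfolding reps_def by auto
qed

lemma rangesI: "u \<in> carrier U \<Longrightarrow> j u = x \<Longrightarrow> u \<otimes> u\<^sup>\<star> \<in> ranges x"
  unfolding ranges_def by auto

lemma ranges_idem [simp]: "e \<in> ranges x \<Longrightarrow> e \<in> idems U"
  unfolding ranges_def by auto

lemma ranges_carrier: "e \<in> ranges x \<Longrightarrow> x \<in> carrier G"
  unfolding ranges_def by auto

lemma ranges_idem_mult:
  assumes "e \<in> ranges x" "f \<in> idems U"
  shows "f \<otimes> e \<in> ranges x"
proof -
  obtain u where u [simp]: "u \<in> carrier U" and ju: "j u = x" and e: "e = u \<otimes> u\<^sup>\<star>"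
    using assms(1) unfolding ranges_def by auto
  have "f \<otimes> u \<otimes> (f \<otimes> u)\<^sup>\<star> = f \<otimes> e"
    using kernel_range_mult[of f u] assms(2) by (simp add: e)
  then show ?thesis
    using rangesI[of "f \<otimes> u" x] assms(2) by (simp add: ju[symmetric])
qed

lemma ranges_rep:
  assumes "e \<in> ranges x"
  shows "\<exists>!r. r \<in> reps x \<and> r \<otimes> r\<^sup>\<star> = e"
proof -
  obtain u where "u \<in> carrier U" "j u = x" "e = u \<otimes> u\<^sup>\<star>"
    using assms unfolding ranges_def by auto
  then show ?thesis
    using \<tau>_reps \<tau>_range reps_unique by metis
qed

lemma reps_range: "r \<in> reps x \<Longrightarrow> r \<otimes> r\<^sup>\<star> \<in> ranges x"
  using rangesI j_reps by simp

lemma reps_domain: "r \<in> reps x \<Longrightarrow> r\<^sup>\<star> \<otimes> r \<in> ranges (inv\<^bsub>G\<^esub> x)"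
  using rangesI[of "r\<^sup>\<star>"] j_reps by simp

lemma ranges_one: "ranges \<one>\<^bsub>G\<^esub> = idems U"
proof -
  have "e \<in> ranges \<one>\<^bsub>G\<^esub>" if "e \<in> idems U" for e
    using rangesI[of e] that by simp
  then show ?thesis
    by auto
qed

definition rep :: "'g \<Rightarrow> 'u \<Rightarrow> 'u" where
  "rep x e = (THE r. r \<in> reps x \<and> r \<otimes> r\<^sup>\<star> = e)"

lemma rep_eqI: "r \<in> reps x \<Longrightarrow> r \<otimes> r\<^sup>\<star> = e \<Longrightarrow> rep x e = r"
  unfolding rep_def using reps_unique by (intro the_equality) blast+

lemma domain_rep_exists:
  assumes "x \<in> carrier G" "e \<in> ranges (inv\<^bsub>G\<^esub> x)"
  shows "\<exists>!r. r \<in> reps x \<and> r\<^sup>\<star> \<otimes> r = e"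
proof -
  obtain u where u: "u \<in> carrier U" "j u = inv\<^bsub>G\<^esub> x" "e = u \<otimes> u\<^sup>\<star>"
    using assms unfolding ranges_def by auto
  \<comment> \<open>Inverting \<open>u\<close> before applying \<open>\<tau>\<close> turns the
    prescribed range \<open>e\<close> into a prescribed domain.\<close>
  have "\<tau> (u\<^sup>\<star>) \<in> reps x"
    using u assms by (intro \<tau>_reps) simp_all
  moreover have "(\<tau> (u\<^sup>\<star>))\<^sup>\<star> \<otimes> \<tau> (u\<^sup>\<star>) = e"
    using u range_eq_imp_domain_eq[of "\<tau> (u\<^sup>\<star>)" "u\<^sup>\<star>"] \<tau>_range[of "u\<^sup>\<star>"] by simp
  ultimately show ?thesis
    using reps_unique_domain by blast
qed

definition drep :: "'g \<Rightarrow> 'u \<Rightarrow> 'u" where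
  "drep x e = (THE r. r \<in> reps x \<and> r\<^sup>\<star> \<otimes> r = e)"

lemma drep_eqI: "r \<in> reps x \<Longrightarrow> r\<^sup>\<star> \<otimes> r = e \<Longrightarrow> drep x e = r"
  unfolding drep_def using reps_unique_domain by (intro the_equality) blast+

section \<open>Conjugation and twist in terms of representatives\<close>

definition th :: "'g \<Rightarrow> 'u \<Rightarrow> 'u" where
  "th x a = drep x (a \<otimes> a\<^sup>\<star>) \<otimes> (a \<otimes> (drep x (a \<otimes> a\<^sup>\<star>))\<^sup>\<star>)"

text \<open>Frees calculations from the choice made in \<open>th\<close>: any representative whose
  domain acts as an identity on \<open>a\<close> may be used, because cutting it down to
  \<open>a a\<^sup>\<star>\<close> yields the selected one and \<open>a\<close> absorbs the
  difference.\<close>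

lemma th_eq:
  assumes r: "r \<in> reps x" and a [simp]: "a \<in> carrier U" and ja: "j a = \<one>\<^bsub>G\<^esub>"
    and ra: "r\<^sup>\<star> \<otimes> (r \<otimes> a) = a"
  shows "th x a = r \<otimes> (a \<otimes> r\<^sup>\<star>)"
proof -
  note [simp] = reps_closed[OF r]
  define e where "e = a \<otimes> a\<^sup>\<star>"
  have [simp]: "e \<in> idems U" "e \<in> carrier U"
    by (simp_all add: e_def)
  have "r\<^sup>\<star> \<otimes> (r \<otimes> e) = e"
    using arg_cong[OF ra, of "\<lambda>v. v \<otimes> a\<^sup>\<star>"] by (simp add: e_def)
  then have "(r \<otimes> e)\<^sup>\<star> \<otimes> (r \<otimes> e) = e"
    by simp
  then have d: "drep x e = r \<otimes> e"
    using reps_mult_idem[OF r] by (intro drep_eqI) simp_all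
  have "a \<otimes> e = a" "e \<otimes> a = a"
    using idem_central[of e a] ja by (simp_all add: e_def)
  then have "a \<otimes> (e \<otimes> z) = a \<otimes> z" "e \<otimes> (a \<otimes> z) = a \<otimes> z" if "z \<in> carrier U" for z
    using that by (metis \<open>e \<in> carrier U\<close> a m_assoc)+
  then show ?thesis
    unfolding th_def e_def[symmetric] d by simp
qed

text \<open>Taking the second representative at the domain of the first keeps their product from
  shrinking below \<open>e\<close>.\<close>

definition om :: "'g \<Rightarrow> 'g \<Rightarrow> 'u \<Rightarrow> 'u" where
  "om x y e = (let r = rep x e in r \<otimes> (rep y (r\<^sup>\<star> \<otimes> r) \<otimes> (rep (x \<otimes>\<^bsub>G\<^esub> y) e)\<^sup>\<star>))"

lemma om_eq:
  assumes "r \<in> reps x" "s \<in> reps y" "q \<in> reps (x \<otimes>\<^bsub>G\<^esub> y)"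
    and "r \<otimes> r\<^sup>\<star> = e" "r\<^sup>\<star> \<otimes> r = s \<otimes> s\<^sup>\<star>" "q \<otimes> q\<^sup>\<star> = e"
  shows "om x y e = r \<otimes> (s \<otimes> q\<^sup>\<star>)"
  unfolding om_def Let_def rep_eqI[OF assms(1,4)] rep_eqI[OF assms(3,6)]
    rep_eqI[OF assms(2) assms(5)[symmetric]] ..

text \<open>A representative over \<open>y\<close> exists at the domain of \<open>r\<close> because
  \<open>r\<^sup>\<star> q\<close> lies over \<open>y\<close> and has exactly that range. Then
  \<open>r s\<close> and \<open>q\<close> share range and image in \<open>G\<close>, hence also the
  domain.\<close>

lemma om_reps_exist:
  assumes xy: "x \<in> carrier G" "y \<in> carrier G" and e: "e \<in> ranges x" "e \<in> ranges (x \<otimes>\<^bsub>G\<^esub> y)"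
  obtains r s q where "r \<in> reps x" "s \<in> reps y" "q \<in> reps (x \<otimes>\<^bsub>G\<^esub> y)"
    "r \<otimes> r\<^sup>\<star> = e" "r\<^sup>\<star> \<otimes> r = s \<otimes> s\<^sup>\<star>" "q \<otimes> q\<^sup>\<star> = e" "q\<^sup>\<star> \<otimes> q = s\<^sup>\<star> \<otimes> s"
proof -
  obtain r where r: "r \<in> reps x" "r \<otimes> r\<^sup>\<star> = e"
    using ranges_rep[OF e(1)] by blast
  obtain q where q: "q \<in> reps (x \<otimes>\<^bsub>G\<^esub> y)" "q \<otimes> q\<^sup>\<star> = e"
    using ranges_rep[OF e(2)] by blast
  note [simp] = reps_closed[OF r(1)] reps_closed[OF q(1)]
  have qe: "q \<otimes> (q\<^sup>\<star> \<otimes> z) = r \<otimes> (r\<^sup>\<star> \<otimes> z)" if "z \<in> carrier U" for z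
    using r(2) q(2) that by (metis \<open>q \<in> carrier U\<close> \<open>r \<in> carrier U\<close> m_assoc star_closed)
  have "r\<^sup>\<star> \<otimes> q \<otimes> (r\<^sup>\<star> \<otimes> q)\<^sup>\<star> = r\<^sup>\<star> \<otimes> r"
    by (simp add: qe)
  moreover have "j (r\<^sup>\<star> \<otimes> q) = y"
    using xy by (simp add: j_reps[OF r(1)] j_reps[OF q(1)] G.inv_solve_left')
  ultimately have "r\<^sup>\<star> \<otimes> r \<in> ranges y"
    using rangesI[of "r\<^sup>\<star> \<otimes> q" y] by simp
  then obtain s where s: "s \<in> reps y" "s \<otimes> s\<^sup>\<star> = r\<^sup>\<star> \<otimes> r"
    using ranges_rep by blast
  note [simp] = reps_closed[OF s(1)]
  have sr: "s \<otimes> (s\<^sup>\<star> \<otimes> z) = r\<^sup>\<star> \<otimes> (r \<otimes> z)" if "z \<in> carrier U" for z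
    using s(2) that by (metis \<open>s \<in> carrier U\<close> \<open>r \<in> carrier U\<close> m_assoc star_closed)
  have "q\<^sup>\<star> \<otimes> q = (r \<otimes> s)\<^sup>\<star> \<otimes> (r \<otimes> s)"
  proof (rule range_eq_imp_domain_eq)
    show "j q = j (r \<otimes> s)"
      by (simp add: j_reps[OF r(1)] j_reps[OF q(1)] j_reps[OF s(1)])
    show "q \<otimes> q\<^sup>\<star> = r \<otimes> s \<otimes> (r \<otimes> s)\<^sup>\<star>"
      by (simp add: sr q(2) flip: r(2))
  qed simp_all
  also have "\<dots> = s\<^sup>\<star> \<otimes> s"
    by (simp flip: sr)
  finally show ?thesis
    by (rule that[OF r(1) s(1) q(1) r(2) s(2)[symmetric] q(2)])
qed

end

section \<open>Partial isomorphisms and twist inside the extension\<close>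

context tau_ext
begin

text \<open>In each equation both sides are restrictions of representatives to the same idempotent,
  so uniqueness in \<open>reps x\<close> identifies them. This allows one representative to be
  exchanged for another.\<close>

lemma reps_compatible:
  assumes r: "r \<in> reps x" and s: "s \<in> reps x"
  shows "r \<otimes> (s\<^sup>\<star> \<otimes> s) = s \<otimes> (r\<^sup>\<star> \<otimes> r)" "s \<otimes> (s\<^sup>\<star> \<otimes> r) = r \<otimes> (r\<^sup>\<star> \<otimes> s)"
proof -
  note [simp] = reps_closed[OF r] reps_closed[OF s]
  show "r \<otimes> (s\<^sup>\<star> \<otimes> s) = s \<otimes> (r\<^sup>\<star> \<otimes> r)"
  proof (rule reps_unique_domain)
    show "r \<otimes> (s\<^sup>\<star> \<otimes> s) \<in> reps x" "s \<otimes> (r\<^sup>\<star> \<otimes> r) \<in> reps x"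
      using r s by (simp_all add: reps_mult_idem)
    have "(s\<^sup>\<star> \<otimes> s) \<otimes> ((r\<^sup>\<star> \<otimes> r) \<otimes> (s\<^sup>\<star> \<otimes> s)) = (r\<^sup>\<star> \<otimes> r) \<otimes> ((s\<^sup>\<star> \<otimes> s) \<otimes> (r\<^sup>\<star> \<otimes> r))"
      by (rule idem_sandwich) simp_all
    then show "(r \<otimes> (s\<^sup>\<star> \<otimes> s))\<^sup>\<star> \<otimes> (r \<otimes> (s\<^sup>\<star> \<otimes> s)) = (s \<otimes> (r\<^sup>\<star> \<otimes> r))\<^sup>\<star> \<otimes> (s \<otimes> (r\<^sup>\<star> \<otimes> r))"
      by simp
  qed
  have "(s \<otimes> s\<^sup>\<star>) \<otimes> r = (r \<otimes> r\<^sup>\<star>) \<otimes> s"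
  proof (rule reps_unique)
    show "(s \<otimes> s\<^sup>\<star>) \<otimes> r \<in> reps x" "(r \<otimes> r\<^sup>\<star>) \<otimes> s \<in> reps x"
      using r s by (simp_all add: reps_idem_mult del: m_assoc)
    have "(s \<otimes> s\<^sup>\<star>) \<otimes> ((r \<otimes> r\<^sup>\<star>) \<otimes> (s \<otimes> s\<^sup>\<star>)) = (r \<otimes> r\<^sup>\<star>) \<otimes> ((s \<otimes> s\<^sup>\<star>) \<otimes> (r \<otimes> r\<^sup>\<star>))"
      by (rule idem_sandwich) simp_all
    then show "((s \<otimes> s\<^sup>\<star>) \<otimes> r) \<otimes> ((s \<otimes> s\<^sup>\<star>) \<otimes> r)\<^sup>\<star> = ((r \<otimes> r\<^sup>\<star>) \<otimes> s) \<otimes> ((r \<otimes> r\<^sup>\<star>) \<otimes> s)\<^sup>\<star>"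
      by simp
  qed
  then show "s \<otimes> (s\<^sup>\<star> \<otimes> r) = r \<otimes> (r\<^sup>\<star> \<otimes> s)"
    by simp
qed

section \<open>The ideals of the kernel and the conjugations between them\<close>

definition kdom :: "'g \<Rightarrow> 'u set" where
  "kdom x = {a \<in> carrier U. j a = \<one>\<^bsub>G\<^esub> \<and> a \<otimes> a\<^sup>\<star> \<in> ranges x}"

lemma kdomI: "a \<in> carrier U \<Longrightarrow> j a = \<one>\<^bsub>G\<^esub> \<Longrightarrow> a \<otimes> a\<^sup>\<star> \<in> ranges x \<Longrightarrow> a \<in> kdom x"
  unfolding kdom_def by simp

lemma kdomD: "a \<in> kdom x \<Longrightarrow> a \<in> carrier U" "a \<in> kdom x \<Longrightarrow> j a = \<one>\<^bsub>G\<^esub>"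
  "a \<in> kdom x \<Longrightarrow> a \<otimes> a\<^sup>\<star> \<in> ranges x"
  unfolding kdom_def by auto

lemma kdom_mult:
  assumes "a \<in> kdom x" "b \<in> carrier U" "j b = \<one>\<^bsub>G\<^esub>"
  shows "a \<otimes> b \<in> kdom x" "b \<otimes> a \<in> kdom x"
proof -
  note [simp] = kdomD(1,2)[OF assms(1)] assms(2,3)
  have m: "(b \<otimes> b\<^sup>\<star>) \<otimes> (a \<otimes> a\<^sup>\<star>) \<in> ranges x"
    using kdomD(3)[OF assms(1)] by (rule ranges_idem_mult) simp_all
  have c: "(a \<otimes> a\<^sup>\<star>) \<otimes> (b \<otimes> b\<^sup>\<star>) = (b \<otimes> b\<^sup>\<star>) \<otimes> (a \<otimes> a\<^sup>\<star>)"
    by (rule idem_comm) simp_all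
  have "a \<otimes> b \<otimes> (a \<otimes> b)\<^sup>\<star> \<in> ranges x"
    using m kernel_range_mult[of a b] c by (simp del: m_assoc star_mult)
  then show "a \<otimes> b \<in> kdom x"
    by (intro kdomI) simp_all
  have "b \<otimes> a \<otimes> (b \<otimes> a)\<^sup>\<star> \<in> ranges x"
    using m kernel_range_mult[of b a] by (simp del: m_assoc star_mult)
  then show "b \<otimes> a \<in> kdom x"
    by (intro kdomI) simp_all
qed

text \<open>Fitting the domain of \<open>r\<close> exactly to \<open>a a\<^sup>\<star>\<close>,
  instead of merely above it, makes the range of the conjugate equal to that of
  \<open>r\<close>.\<close>

lemma th_rep:
  assumes x: "x \<in> carrier G" and a: "a \<in> kdom (inv\<^bsub>G\<^esub> x)"
  obtains r where "r \<in> reps x" "r\<^sup>\<star> \<otimes> r = a \<otimes> a\<^sup>\<star>" "r\<^sup>\<star> \<otimes> (r \<otimes> a) = a" "a \<otimes> (r\<^sup>\<star> \<otimes> r) = a"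
    "th x a = r \<otimes> (a \<otimes> r\<^sup>\<star>)" "th x a \<otimes> (th x a)\<^sup>\<star> = r \<otimes> r\<^sup>\<star>"
proof -
  note [simp] = kdomD(1,2)[OF a]
  obtain r where r: "r \<in> reps x" and d: "r\<^sup>\<star> \<otimes> r = a \<otimes> a\<^sup>\<star>"
    using domain_rep_exists[OF x kdomD(3)[OF a]] by blast
  note [simp] = reps_closed[OF r]
  have ra: "r\<^sup>\<star> \<otimes> (r \<otimes> a) = a"
    using mult_eq_mult_assoc[OF d, of a] by simp
  have ar: "a \<otimes> (r\<^sup>\<star> \<otimes> r) = a"
    using idem_central[of "a \<otimes> a\<^sup>\<star>" a] by (simp add: d)
  have t: "th x a = r \<otimes> (a \<otimes> r\<^sup>\<star>)"
    by (rule th_eq[OF r _ _ ra]) simp_all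
  have "th x a \<otimes> (th x a)\<^sup>\<star> = r \<otimes> ((a \<otimes> (r\<^sup>\<star> \<otimes> r)) \<otimes> a\<^sup>\<star>) \<otimes> r\<^sup>\<star>"
    by (simp add: t)
  also have "\<dots> = r \<otimes> r\<^sup>\<star>"
    unfolding ar d[symmetric] by simp
  finally show ?thesis
    using that[OF r d ra ar t] by simp
qed

lemma th_dom:
  assumes x: "x \<in> carrier G" and a: "a \<in> kdom (inv\<^bsub>G\<^esub> x)"
  shows "th x a \<in> kdom x"
proof -
  obtain r where r: "r \<in> reps x" "th x a = r \<otimes> (a \<otimes> r\<^sup>\<star>)" "th x a \<otimes> (th x a)\<^sup>\<star> = r \<otimes> r\<^sup>\<star>"
    using th_rep[OF assms] by metis
  have "th x a \<in> carrier U" "j (th x a) = \<one>\<^bsub>G\<^esub>"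
    using x kdomD[OF a] j_reps[OF r(1)] reps_closed[OF r(1)] by (simp_all add: r(2))
  then show ?thesis
    by (rule kdomI) (use reps_range[OF r(1)] in \<open>simp add: r(3)\<close>)
qed

text \<open>\<open>a\<close> and \<open>b\<close> come with different representatives, so the
  product of the conjugates has \<open>r\<^sup>\<star> s\<close> in the middle and ends in
  \<open>s\<^sup>\<star>\<close> instead of \<open>r\<^sup>\<star>\<close>. Compatibility repairs
  both: \<open>r\<^sup>\<star> s\<close> acts as an identity between \<open>a\<close> and
  \<open>b\<close>, and the domain of \<open>r\<close>, carried past \<open>b\<close>, turns
  \<open>s\<^sup>\<star>\<close> into \<open>r\<^sup>\<star>\<close>.\<close>

lemma th_mult:
  assumes x: "x \<in> carrier G" and a: "a \<in> kdom (inv\<^bsub>G\<^esub> x)" and b: "b \<in> kdom (inv\<^bsub>G\<^esub> x)"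
  shows "th x (a \<otimes> b) = th x a \<otimes> th x b"
proof -
  note [simp] = kdomD(1,2)[OF a] kdomD(1,2)[OF b]
  obtain r where r: "r \<in> reps x" and ra: "r\<^sup>\<star> \<otimes> (r \<otimes> a) = a" and ar: "a \<otimes> (r\<^sup>\<star> \<otimes> r) = a"
      and ta: "th x a = r \<otimes> (a \<otimes> r\<^sup>\<star>)"
    using th_rep[OF x a] by metis
  obtain s where s: "s \<in> reps x" and sb: "s\<^sup>\<star> \<otimes> (s \<otimes> b) = b" and bs: "b \<otimes> (s\<^sup>\<star> \<otimes> s) = b"
      and tb: "th x b = s \<otimes> (b \<otimes> s\<^sup>\<star>)"
    using th_rep[OF x b] by metis
  note [simp] = reps_closed[OF r] reps_closed[OF s]
  define f g h where "f = r\<^sup>\<star> \<otimes> r" "g = s\<^sup>\<star> \<otimes> s" "h = r\<^sup>\<star> \<otimes> s"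
  have [simp]: "f \<in> idems U" "g \<in> idems U"
    by (simp_all add: f_g_h_def)
  \<comment> \<open>A conjugate of the range of \<open>s\<close> by \<open>r\<^sup>\<star>\<close>,
    hence idempotent.\<close>
  have "h = r\<^sup>\<star> \<otimes> ((s \<otimes> s\<^sup>\<star>) \<otimes> r)"
    by (simp add: f_g_h_def reps_compatible(2)[OF r s])
  then have [simp]: "h \<in> idems U"
    using conj_idem[of "r\<^sup>\<star>" "s \<otimes> s\<^sup>\<star>"] by simp
  have fhg: "f \<otimes> (h \<otimes> g) = f \<otimes> g"
  proof -
    have "f \<otimes> (h \<otimes> g) = h \<otimes> (f \<otimes> g)"
      by (simp add: idem_left_comm)
    also have "\<dots> = r\<^sup>\<star> \<otimes> (s \<otimes> (r\<^sup>\<star> \<otimes> r)) \<otimes> g"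
      by (simp add: f_g_h_def)
    also have "\<dots> = f \<otimes> g"
      unfolding reps_compatible(1)[OF r s, symmetric] by (simp add: f_g_h_def)
    finally show ?thesis .
  qed
  have ahb: "a \<otimes> (h \<otimes> b) = a \<otimes> b"
  proof -
    have "a \<otimes> (h \<otimes> b) = (a \<otimes> f) \<otimes> (h \<otimes> (g \<otimes> b))"
      using ar sb by (simp add: f_g_h_def)
    also have "\<dots> = a \<otimes> (f \<otimes> (h \<otimes> g)) \<otimes> b"
      by simp
    also have "\<dots> = (a \<otimes> f) \<otimes> (g \<otimes> b)"
      unfolding fhg by simp
    also have "\<dots> = a \<otimes> b"
      using ar sb by (simp add: f_g_h_def)
    finally show ?thesis .
  qed
  have fb: "f \<otimes> b = b \<otimes> f"
    by (rule idem_central) simp_all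
  have star: "g \<otimes> r\<^sup>\<star> = f \<otimes> s\<^sup>\<star>"
    using arg_cong[OF reps_compatible(1)[OF r s], of "sg_inv U"] by (simp add: f_g_h_def)
  have "th x a \<otimes> th x b = r \<otimes> ((a \<otimes> (h \<otimes> b)) \<otimes> s\<^sup>\<star>)"
    by (simp add: ta tb f_g_h_def)
  also have "\<dots> = r \<otimes> (((a \<otimes> f) \<otimes> b) \<otimes> s\<^sup>\<star>)"
    unfolding ahb using ar by (simp add: f_g_h_def)
  also have "\<dots> = r \<otimes> (a \<otimes> ((f \<otimes> b) \<otimes> s\<^sup>\<star>))"
    by simp
  also have "\<dots> = r \<otimes> (a \<otimes> (b \<otimes> (g \<otimes> r\<^sup>\<star>)))"
    unfolding fb star by simp
  also have "\<dots> = r \<otimes> (a \<otimes> ((b \<otimes> g) \<otimes> r\<^sup>\<star>))"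
    by simp
  also have "b \<otimes> g = b"
    using bs by (simp add: f_g_h_def)
  also have "r \<otimes> (a \<otimes> (b \<otimes> r\<^sup>\<star>)) = th x (a \<otimes> b)"
    using arg_cong[OF ra, of "\<lambda>v. v \<otimes> b"] th_eq[OF r, of "a \<otimes> b"] by simp
  finally show ?thesis ..
qed

lemma th_preimage:
  assumes x: "x \<in> carrier G" and b: "b \<in> kdom x" and r: "r \<in> reps x" and rb: "r \<otimes> r\<^sup>\<star> = b \<otimes> b\<^sup>\<star>"
  shows "r\<^sup>\<star> \<otimes> (b \<otimes> r) \<in> kdom (inv\<^bsub>G\<^esub> x)" "th x (r\<^sup>\<star> \<otimes> (b \<otimes> r)) = b"
    "(r\<^sup>\<star> \<otimes> (b \<otimes> r)) \<otimes> (r\<^sup>\<star> \<otimes> (b \<otimes> r))\<^sup>\<star> = r\<^sup>\<star> \<otimes> r"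
proof -
  note [simp] = kdomD(1,2)[OF b] reps_closed[OF r]
  have br: "b \<otimes> (r \<otimes> r\<^sup>\<star>) = b"
    using idem_central[of "b \<otimes> b\<^sup>\<star>" b] by (simp add: rb)
  have rb': "r \<otimes> (r\<^sup>\<star> \<otimes> b) = b"
    using mult_eq_mult_assoc[OF rb, of b] by simp
  have jr: "j r = x"
    using r by (rule j_reps)
  have rng: "(r\<^sup>\<star> \<otimes> (b \<otimes> r)) \<otimes> (r\<^sup>\<star> \<otimes> (b \<otimes> r))\<^sup>\<star> = r\<^sup>\<star> \<otimes> ((b \<otimes> (r \<otimes> r\<^sup>\<star>)) \<otimes> b\<^sup>\<star>) \<otimes> r"
    by simp
  also have "\<dots> = r\<^sup>\<star> \<otimes> r"
    unfolding br by (simp flip: rb)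
  finally show rng: "(r\<^sup>\<star> \<otimes> (b \<otimes> r)) \<otimes> (r\<^sup>\<star> \<otimes> (b \<otimes> r))\<^sup>\<star> = r\<^sup>\<star> \<otimes> r" .
  show "r\<^sup>\<star> \<otimes> (b \<otimes> r) \<in> kdom (inv\<^bsub>G\<^esub> x)"
    by (rule kdomI) (use x reps_domain[OF r] in \<open>simp_all add: rng jr del: m_assoc star_mult\<close>)
  have "th x (r\<^sup>\<star> \<otimes> (b \<otimes> r)) = r \<otimes> ((r\<^sup>\<star> \<otimes> (b \<otimes> r)) \<otimes> r\<^sup>\<star>)"
    by (rule th_eq[OF r]) (use x in \<open>simp_all add: jr\<close>)
  also have "\<dots> = b"
    using rb' br by simp
  finally show "th x (r\<^sup>\<star> \<otimes> (b \<otimes> r)) = b" .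
qed

text \<open>The representative can be recovered from the value, since its range is the range of the
  conjugate. So both conjugations use the same \<open>r\<close> and are undone by it.\<close>

lemma th_inj:
  assumes x: "x \<in> carrier G" and a: "a \<in> kdom (inv\<^bsub>G\<^esub> x)" and b: "b \<in> kdom (inv\<^bsub>G\<^esub> x)"
    and eq: "th x a = th x b"
  shows "a = b"
proof -
  note [simp] = kdomD(1,2)[OF a] kdomD(1,2)[OF b]
  obtain r where r: "r \<in> reps x" and ra: "r\<^sup>\<star> \<otimes> (r \<otimes> a) = a" and ar: "a \<otimes> (r\<^sup>\<star> \<otimes> r) = a"
      and ta: "th x a = r \<otimes> (a \<otimes> r\<^sup>\<star>)" "th x a \<otimes> (th x a)\<^sup>\<star> = r \<otimes> r\<^sup>\<star>"
    using th_rep[OF x a] by metis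
  obtain s where s: "s \<in> reps x" and sb: "s\<^sup>\<star> \<otimes> (s \<otimes> b) = b" and bs: "b \<otimes> (s\<^sup>\<star> \<otimes> s) = b"
      and tb: "th x b = s \<otimes> (b \<otimes> s\<^sup>\<star>)" "th x b \<otimes> (th x b)\<^sup>\<star> = s \<otimes> s\<^sup>\<star>"
    using th_rep[OF x b] by metis
  note [simp] = reps_closed[OF r] reps_closed[OF s]
  have rs: "s = r"
    using reps_unique[OF s r] ta(2) tb(2) eq by metis
  have "r\<^sup>\<star> \<otimes> (th x a \<otimes> r) = a"
    by (simp add: ta(1) ar ra)
  moreover have "r\<^sup>\<star> \<otimes> (th x b \<otimes> r) = b"
    using bs sb by (simp add: tb(1) rs)
  ultimately show ?thesis
    using eq by metis
qed

lemma th_bij: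
  assumes x: "x \<in> carrier G"
  shows "bij_betw (th x) (kdom (inv\<^bsub>G\<^esub> x)) (kdom x)"
proof -
  have "\<exists>a\<in>kdom (inv\<^bsub>G\<^esub> x). b = th x a" if b: "b \<in> kdom x" for b
    using ranges_rep[OF kdomD(3)[OF b]] th_preimage[OF x b] by metis
  then show ?thesis
    using th_dom[OF x] th_inj[OF x] by (auto simp: bij_betw_def inj_on_def)
qed

text \<open>If the domain of \<open>r\<close> over \<open>x\<close> and the range of
  \<open>s\<close> over \<open>y\<close> are both \<open>a a\<^sup>\<star>\<close>, then
  \<open>r s\<close> lies over the product and has the range of \<open>r\<close>. Conversely,
  \<open>om_reps_exist\<close> provides such a pair for an idempotent in both range sets.\<close>

lemma th_image:
  assumes x: "x \<in> carrier G" and y: "y \<in> carrier G"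
  shows "th x ` (kdom (inv\<^bsub>G\<^esub> x) \<inter> kdom y) = kdom x \<inter> kdom (x \<otimes>\<^bsub>G\<^esub> y)"
proof (intro equalityI subsetI)
  fix b assume "b \<in> th x ` (kdom (inv\<^bsub>G\<^esub> x) \<inter> kdom y)"
  then obtain a where a: "a \<in> kdom (inv\<^bsub>G\<^esub> x)" and ay: "a \<in> kdom y" and b: "b = th x a"
    by blast
  obtain r where r: "r \<in> reps x" and d: "r\<^sup>\<star> \<otimes> r = a \<otimes> a\<^sup>\<star>"
      and ta: "th x a \<otimes> (th x a)\<^sup>\<star> = r \<otimes> r\<^sup>\<star>"
    using th_rep[OF x a] by metis
  obtain s where s: "s \<in> reps y" and sa: "s \<otimes> s\<^sup>\<star> = a \<otimes> a\<^sup>\<star>"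
    using ranges_rep[OF kdomD(3)[OF ay]] by blast
  note [simp] = kdomD(1,2)[OF a] reps_closed[OF r] reps_closed[OF s]
  have "r \<otimes> s \<otimes> (r \<otimes> s)\<^sup>\<star> = r \<otimes> (s \<otimes> s\<^sup>\<star>) \<otimes> r\<^sup>\<star>"
    by simp
  also have "\<dots> = r \<otimes> r\<^sup>\<star>"
    unfolding sa d[symmetric] by simp
  finally have "r \<otimes> r\<^sup>\<star> \<in> ranges (x \<otimes>\<^bsub>G\<^esub> y)"
    using rangesI[of "r \<otimes> s"] j_reps[OF r] j_reps[OF s] by simp
  moreover have "b \<in> kdom x"
    using th_dom[OF x a] b by simp
  ultimately show "b \<in> kdom x \<inter> kdom (x \<otimes>\<^bsub>G\<^esub> y)"
    using ta b kdomD[of b x] by (auto intro!: kdomI)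
next
  fix b assume b: "b \<in> kdom x \<inter> kdom (x \<otimes>\<^bsub>G\<^esub> y)"
  then have bx: "b \<in> kdom x"
    by simp
  obtain r s where r: "r \<in> reps x" and rb: "r \<otimes> r\<^sup>\<star> = b \<otimes> b\<^sup>\<star>" and s: "s \<in> reps y" and rs: "r\<^sup>\<star> \<otimes> r = s \<otimes> s\<^sup>\<star>"
    using om_reps_exist[OF x y, of "b \<otimes> b\<^sup>\<star>"] b kdomD(3) by (metis IntD1 IntD2)
  note P = th_preimage[OF x bx r rb]
  have "r\<^sup>\<star> \<otimes> (b \<otimes> r) \<in> kdom y"
    using kdomD(1,2)[OF P(1)] P(3) rs reps_range[OF s] by (intro kdomI) simp_all
  then show "b \<in> th x ` (kdom (inv\<^bsub>G\<^esub> x) \<inter> kdom y)"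
    using P(1,2) by (metis IntI image_eqI)
qed

text \<open>The last claim, compatibility with restriction, is what will make multiplication by
  \<open>om x y\<close> at varying idempotents a multiplier.\<close>

lemma om_kernel:
  assumes xy: "x \<in> carrier G" "y \<in> carrier G" and e: "e \<in> ranges x" "e \<in> ranges (x \<otimes>\<^bsub>G\<^esub> y)"
  shows "om x y e \<in> carrier U" "j (om x y e) = \<one>\<^bsub>G\<^esub>" "om x y e \<otimes> (om x y e)\<^sup>\<star> = e"
    "f \<in> idems U \<Longrightarrow> om x y (f \<otimes> e) = f \<otimes> om x y e"
proof -
  obtain r s q where r: "r \<in> reps x" and s: "s \<in> reps y" and q: "q \<in> reps (x \<otimes>\<^bsub>G\<^esub> y)"
    and re: "r \<otimes> r\<^sup>\<star> = e" and rs: "r\<^sup>\<star> \<otimes> r = s \<otimes> s\<^sup>\<star>" and qe: "q \<otimes> q\<^sup>\<star> = e" and qs: "q\<^sup>\<star> \<otimes> q = s\<^sup>\<star> \<otimes> s"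
    using om_reps_exist[OF assms] by metis
  note [simp] = reps_closed[OF r] reps_closed[OF s] reps_closed[OF q] ranges_idem[OF e(1)]
  note o = om_eq[OF r s q re rs qe]
  show oc [simp]: "om x y e \<in> carrier U"
    by (simp add: o)
  show oj: "j (om x y e) = \<one>\<^bsub>G\<^esub>"
    using xy by (simp add: o j_reps[OF r] j_reps[OF s] j_reps[OF q] G.inv_mult_group G.m_assoc)
      (simp add: G.m_assoc[symmetric])
  have "om x y e \<otimes> (om x y e)\<^sup>\<star> = r \<otimes> (s \<otimes> (q\<^sup>\<star> \<otimes> q) \<otimes> s\<^sup>\<star>) \<otimes> r\<^sup>\<star>"
    by (simp add: o)
  also have "\<dots> = r \<otimes> (s \<otimes> s\<^sup>\<star>) \<otimes> r\<^sup>\<star>"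
    unfolding qs by simp
  also have "\<dots> = e"
    unfolding rs[symmetric] by (simp add: re)
  finally show "om x y e \<otimes> (om x y e)\<^sup>\<star> = e" .
  assume f [simp]: "f \<in> idems U"
  \<comment> \<open>\<open>f\<close> carried across \<open>r\<close> to its domain side, so that
    \<open>r g = f r\<close>; then \<open>g s\<close> is the restriction of \<open>s\<close> that
    fits \<open>f r\<close>.\<close>
  define g where "g = r\<^sup>\<star> \<otimes> (f \<otimes> r)"
  have [simp]: "g \<in> idems U"
    using conj_idem[of "r\<^sup>\<star>" f] by (simp add: g_def)
  have fr: "r \<otimes> g = f \<otimes> r"
    using idem_left_comm[of "r \<otimes> r\<^sup>\<star>" f r] by (simp add: g_def)
  have gr: "g \<otimes> (r\<^sup>\<star> \<otimes> r) = g"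
    by (simp add: g_def)
  have "om x y (f \<otimes> e) = f \<otimes> r \<otimes> ((g \<otimes> s) \<otimes> (f \<otimes> q)\<^sup>\<star>)"
  proof (rule om_eq)
    show "f \<otimes> r \<in> reps x" "g \<otimes> s \<in> reps y" "f \<otimes> q \<in> reps (x \<otimes>\<^bsub>G\<^esub> y)"
      using r s q by (simp_all add: reps_idem_mult)
    show "f \<otimes> r \<otimes> (f \<otimes> r)\<^sup>\<star> = f \<otimes> e"
      using kernel_range_mult[of f r] re by simp
    show "f \<otimes> q \<otimes> (f \<otimes> q)\<^sup>\<star> = f \<otimes> e"
      using kernel_range_mult[of f q] qe by simp
    have "g \<otimes> s \<otimes> (g \<otimes> s)\<^sup>\<star> = g \<otimes> (s \<otimes> s\<^sup>\<star>)"
      using kernel_range_mult[of g s] by simp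
    also have "\<dots> = g"
      by (simp add: gr flip: rs)
    finally show "(f \<otimes> r)\<^sup>\<star> \<otimes> (f \<otimes> r) = g \<otimes> s \<otimes> (g \<otimes> s)\<^sup>\<star>"
      by (simp add: g_def)
  qed
  also have "\<dots> = f \<otimes> (r \<otimes> g) \<otimes> (s \<otimes> (q\<^sup>\<star> \<otimes> f))"
    by simp
  also have "\<dots> = f \<otimes> (om x y e \<otimes> f)"
    unfolding fr by (simp add: o)
  also have "om x y e \<otimes> f = f \<otimes> om x y e"
    using idem_central[of f "om x y e"] oj by simp
  finally show "om x y (f \<otimes> e) = f \<otimes> om x y e"
    by simp
qed

section \<open>Multiplication by the twist: normalization, composition, cocycle identity\<close>

definition lmul :: "'g \<Rightarrow> 'g \<Rightarrow> 'u \<Rightarrow> 'u" where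
  "lmul x y a = om x y (a \<otimes> a\<^sup>\<star>) \<otimes> a"

definition rmul :: "'g \<Rightarrow> 'g \<Rightarrow> 'u \<Rightarrow> 'u" where
  "rmul x y a = a \<otimes> om x y (a \<otimes> a\<^sup>\<star>)"

lemma om_one_left:
  assumes "e \<in> ranges x"
  shows "om \<one>\<^bsub>G\<^esub> x e = e"
proof -
  obtain r where r: "r \<in> reps x" "r \<otimes> r\<^sup>\<star> = e"
    using ranges_rep[OF assms] by blast
  have "x \<in> carrier G"
    using assms by (rule ranges_carrier)
  \<comment> \<open>The representative over the identity at \<open>e\<close> is \<open>e\<close>
    itself, so \<open>e\<close>, \<open>r\<close>, \<open>r\<close> is a matching triple.\<close>
  then have "om \<one>\<^bsub>G\<^esub> x e = e \<otimes> (r \<otimes> r\<^sup>\<star>)"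
    using r assms by (intro om_eq) (simp_all add: reps_one)
  then show ?thesis
    using assms r(2) by simp
qed

lemma om_one_right:
  assumes "e \<in> ranges x"
  shows "om x \<one>\<^bsub>G\<^esub> e = e"
proof -
  obtain r where r: "r \<in> reps x" "r \<otimes> r\<^sup>\<star> = e"
    using ranges_rep[OF assms] by blast
  note [simp] = reps_closed[OF r(1)]
  have "x \<in> carrier G"
    using assms by (rule ranges_carrier)
  then have "om x \<one>\<^bsub>G\<^esub> e = r \<otimes> ((r\<^sup>\<star> \<otimes> r) \<otimes> r\<^sup>\<star>)"
    using r by (intro om_eq) (simp_all add: reps_one)
  then show ?thesis
    by (simp flip: r(2))
qed

text \<open>The third claim is condition (iv) with the inverse multiplier moved to the other side,
  so that nothing has to be inverted inside \<open>U\<close>. With \<open>t\<close>,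
  \<open>r\<close>, \<open>q\<close> over \<open>x\<close>, \<open>y\<close> and their product, both
  sides are \<open>t r s q\<^sup>\<star>\<close>.\<close>

lemma th_th:
  assumes xy [simp]: "x \<in> carrier G" "y \<in> carrier G"
    and s: "s \<in> kdom (inv\<^bsub>G\<^esub> y)" "s \<in> kdom (inv\<^bsub>G\<^esub> y \<otimes>\<^bsub>G\<^esub> inv\<^bsub>G\<^esub> x)"
  shows "th x (th y s) \<in> kdom x \<inter> kdom (x \<otimes>\<^bsub>G\<^esub> y)" (is ?A)
    and "th (x \<otimes>\<^bsub>G\<^esub> y) s \<in> kdom x \<inter> kdom (x \<otimes>\<^bsub>G\<^esub> y)" (is ?B)
    and "rmul x y (th x (th y s)) = lmul x y (th (x \<otimes>\<^bsub>G\<^esub> y) s)" (is ?C)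
proof -
  have ys: "th y s \<in> kdom (inv\<^bsub>G\<^esub> x)"
  proof -
    have "th y s \<in> kdom y \<inter> kdom (y \<otimes>\<^bsub>G\<^esub> (inv\<^bsub>G\<^esub> y \<otimes>\<^bsub>G\<^esub> inv\<^bsub>G\<^esub> x))"
      using s by (subst th_image[symmetric]) auto
    then show ?thesis
      by (simp add: G.m_assoc[symmetric])
  qed
  have ysy: "th y s \<in> kdom y"
    using s by (simp add: th_dom)
  show A: ?A
    using ys ysy by (subst th_image[symmetric]) auto
  have sxy: "s \<in> kdom (inv\<^bsub>G\<^esub> (x \<otimes>\<^bsub>G\<^esub> y))"
    using s by (simp add: G.inv_mult_group)
  obtain r where r: "r \<in> reps y" and rd: "r\<^sup>\<star> \<otimes> r = s \<otimes> s\<^sup>\<star>" and sr: "s \<otimes> (r\<^sup>\<star> \<otimes> r) = s"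
      and tr: "th y s = r \<otimes> (s \<otimes> r\<^sup>\<star>)" "th y s \<otimes> (th y s)\<^sup>\<star> = r \<otimes> r\<^sup>\<star>"
    using th_rep[OF xy(2) s(1)] by metis
  obtain t where t: "t \<in> reps x" and td: "t\<^sup>\<star> \<otimes> t = r \<otimes> r\<^sup>\<star>"
      and tt: "th x (th y s) = t \<otimes> (th y s \<otimes> t\<^sup>\<star>)" "th x (th y s) \<otimes> (th x (th y s))\<^sup>\<star> = t \<otimes> t\<^sup>\<star>"
    using th_rep[OF xy(1) ys] tr(2) by metis
  obtain q where q: "q \<in> reps (x \<otimes>\<^bsub>G\<^esub> y)" and qd: "q\<^sup>\<star> \<otimes> q = s \<otimes> s\<^sup>\<star>" and qs: "q\<^sup>\<star> \<otimes> (q \<otimes> s) = s"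
      and tq: "th (x \<otimes>\<^bsub>G\<^esub> y) s = q \<otimes> (s \<otimes> q\<^sup>\<star>)"
        "th (x \<otimes>\<^bsub>G\<^esub> y) s \<otimes> (th (x \<otimes>\<^bsub>G\<^esub> y) s)\<^sup>\<star> = q \<otimes> q\<^sup>\<star>"
    using th_rep[OF _ sxy] xy by (metis G.m_closed)
  note [simp] = reps_closed[OF r] reps_closed[OF t] reps_closed[OF q] kdomD(1,2)[OF s(1)]
  \<comment> \<open>Now \<open>t r\<close> and \<open>q\<close> lie over the same group element with
    the same domain, hence have the same range: both twist multiplications are evaluated at one
    idempotent.\<close>
  have tr_d: "(t \<otimes> r)\<^sup>\<star> \<otimes> (t \<otimes> r) = s \<otimes> s\<^sup>\<star>"
  proof -
    have "(t \<otimes> r)\<^sup>\<star> \<otimes> (t \<otimes> r) = r\<^sup>\<star> \<otimes> (t\<^sup>\<star> \<otimes> t) \<otimes> r"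
      by simp
    also have "\<dots> = s \<otimes> s\<^sup>\<star>"
      unfolding td rd[symmetric] by simp
    finally show ?thesis .
  qed
  have "q \<otimes> q\<^sup>\<star> = (t \<otimes> r) \<otimes> (t \<otimes> r)\<^sup>\<star>"
    by (rule domain_eq_imp_range_eq)
      (use qd tr_d in \<open>simp_all add: j_reps[OF r] j_reps[OF t] j_reps[OF q] del: star_mult m_assoc\<close>)
  also have "\<dots> = t \<otimes> (r \<otimes> r\<^sup>\<star>) \<otimes> t\<^sup>\<star>"
    by simp
  also have "\<dots> = t \<otimes> t\<^sup>\<star>"
    unfolding td[symmetric] by simp
  finally have qt: "q \<otimes> q\<^sup>\<star> = t \<otimes> t\<^sup>\<star>" .
  show ?B
    using th_dom[OF _ sxy] xy tq(2) qt reps_range[OF t]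
    by (auto intro!: kdomI simp: kdomD)
  have o: "om x y (t \<otimes> t\<^sup>\<star>) = t \<otimes> (r \<otimes> q\<^sup>\<star>)"
    by (rule om_eq[OF t r q refl td qt])
  have "rmul x y (th x (th y s)) = t \<otimes> (r \<otimes> (s \<otimes> (r\<^sup>\<star> \<otimes> (t\<^sup>\<star> \<otimes> t) \<otimes> r))) \<otimes> q\<^sup>\<star>"
    unfolding rmul_def tt(2) o unfolding tt(1) unfolding tr(1) by simp
  also have "\<dots> = t \<otimes> (r \<otimes> (s \<otimes> (r\<^sup>\<star> \<otimes> r))) \<otimes> q\<^sup>\<star>"
    unfolding td by simp
  also have "\<dots> = t \<otimes> (r \<otimes> s) \<otimes> q\<^sup>\<star>"
    unfolding sr ..
  also have "\<dots> = t \<otimes> (r \<otimes> (q\<^sup>\<star> \<otimes> (q \<otimes> s))) \<otimes> q\<^sup>\<star>"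
    unfolding qs ..
  also have "\<dots> = lmul x y (th (x \<otimes>\<^bsub>G\<^esub> y) s)"
    unfolding lmul_def tq(2) qt o unfolding tq(1) by simp
  finally show ?C .
qed

text \<open>The twist is evaluated at \<open>a a\<^sup>\<star>\<close> and has that idempotent as
  its range, so multiplying by it cannot shrink \<open>a\<close>.\<close>

lemma rmul_range:
  assumes xy: "x \<in> carrier G" "y \<in> carrier G" and a: "a \<in> kdom x" "a \<in> kdom (x \<otimes>\<^bsub>G\<^esub> y)"
  shows "rmul x y a \<in> carrier U" "j (rmul x y a) = \<one>\<^bsub>G\<^esub>" "rmul x y a \<otimes> (rmul x y a)\<^sup>\<star> = a \<otimes> a\<^sup>\<star>"
proof -
  note o [simp] = om_kernel(1,2)[OF xy kdomD(3)[OF a(1)] kdomD(3)[OF a(2)]] and o3 = om_kernel(3)[OF xy kdomD(3)[OF a(1)] kdomD(3)[OF a(2)]]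
  note [simp] = kdomD(1,2)[OF a(1)]
  show "rmul x y a \<in> carrier U" "j (rmul x y a) = \<one>\<^bsub>G\<^esub>"
    by (simp_all add: rmul_def)
  show "rmul x y a \<otimes> (rmul x y a)\<^sup>\<star> = a \<otimes> a\<^sup>\<star>"
    unfolding rmul_def using kernel_range_mult[of a "om x y (a \<otimes> a\<^sup>\<star>)"] o3 by simp
qed

text \<open>Both sides are \<open>r s v \<zeta> \<xi>\<^sup>\<star>\<close>, with \<open>r\<close>,
  \<open>v\<close>, \<open>\<zeta>\<close>, \<open>\<xi>\<close> over \<open>x\<close>,
  \<open>y\<close>, \<open>z\<close> and the triple product. The auxiliary representatives
  \<open>q\<close> and \<open>\<eta>\<close> over the double products cancel because they are fitted
  to their neighbours.\<close>

lemma rmul_cocycle: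
  assumes xyz [simp]: "x \<in> carrier G" "y \<in> carrier G" "z \<in> carrier G"
    and s: "s \<in> kdom (inv\<^bsub>G\<^esub> x)" "s \<in> kdom y" "s \<in> kdom (y \<otimes>\<^bsub>G\<^esub> z)"
  shows "rmul x (y \<otimes>\<^bsub>G\<^esub> z) (th x (rmul y z s)) = rmul (x \<otimes>\<^bsub>G\<^esub> y) z (rmul x y (th x s))"
proof -
  define e where "e = s \<otimes> s\<^sup>\<star>"
  obtain r where r: "r \<in> reps x" and rd: "r\<^sup>\<star> \<otimes> r = e" and rs: "r\<^sup>\<star> \<otimes> (r \<otimes> s) = s"
      and tr: "th x s = r \<otimes> (s \<otimes> r\<^sup>\<star>)" "th x s \<otimes> (th x s)\<^sup>\<star> = r \<otimes> r\<^sup>\<star>"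
    unfolding e_def using th_rep[OF xyz(1) s(1)] by metis
  obtain v \<zeta> q where v: "v \<in> reps y" and \<zeta>: "\<zeta> \<in> reps z" and q: "q \<in> reps (y \<otimes>\<^bsub>G\<^esub> z)"
    and ve: "v \<otimes> v\<^sup>\<star> = e" and v\<zeta>: "v\<^sup>\<star> \<otimes> v = \<zeta> \<otimes> \<zeta>\<^sup>\<star>" and qe: "q \<otimes> q\<^sup>\<star> = e" and q\<zeta>: "q\<^sup>\<star> \<otimes> q = \<zeta>\<^sup>\<star> \<otimes> \<zeta>"
    unfolding e_def using om_reps_exist[OF xyz(2,3) kdomD(3)[OF s(2)] kdomD(3)[OF s(3)]] by metis
  note [simp] = reps_closed[OF r] reps_closed[OF v] reps_closed[OF \<zeta>] reps_closed[OF q] kdomD(1,2)[OF s(1)]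
  have oyz: "om y z e = v \<otimes> (\<zeta> \<otimes> q\<^sup>\<star>)"
    by (rule om_eq[OF v \<zeta> q ve v\<zeta> qe])
  have ei [simp]: "e \<in> idems U"
    by (simp add: e_def)
  have es: "s \<otimes> e = s"
    using idem_central[of e s] by (simp add: e_def)
  \<comment> \<open>The idempotent \<open>e\<close> transported by \<open>r\<close>. Apart from
    \<open>om y z\<close>, which is taken at \<open>e\<close>, all twists in the identity are
    evaluated here.\<close>
  define g where "g = r \<otimes> r\<^sup>\<star>"
  have g: "r \<otimes> (e \<otimes> r\<^sup>\<star>) = g"
    by (simp add: g_def flip: rd)
  have "r \<otimes> v \<otimes> (r \<otimes> v)\<^sup>\<star> = r \<otimes> ((v \<otimes> v\<^sup>\<star>) \<otimes> r\<^sup>\<star>)"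
    by simp
  also have "\<dots> = g"
    unfolding ve by (rule g)
  finally have grv: "r \<otimes> v \<otimes> (r \<otimes> v)\<^sup>\<star> = g" .
  then have gxy: "g \<in> ranges (x \<otimes>\<^bsub>G\<^esub> y)"
    using rangesI[of "r \<otimes> v"] j_reps[OF r] j_reps[OF v] by simp
  have "r \<otimes> q \<otimes> (r \<otimes> q)\<^sup>\<star> = r \<otimes> ((q \<otimes> q\<^sup>\<star>) \<otimes> r\<^sup>\<star>)"
    by simp
  also have "\<dots> = g"
    unfolding qe by (rule g)
  finally have gxyz: "g \<in> ranges (x \<otimes>\<^bsub>G\<^esub> (y \<otimes>\<^bsub>G\<^esub> z))"
    using rangesI[of "r \<otimes> q"] j_reps[OF r] j_reps[OF q] by simp
  obtain \<eta> where \<eta>: "\<eta> \<in> reps (x \<otimes>\<^bsub>G\<^esub> y)" and \<eta>g: "\<eta> \<otimes> \<eta>\<^sup>\<star> = g"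
    using ranges_rep[OF gxy] by blast
  obtain \<xi> where \<xi>: "\<xi> \<in> reps (x \<otimes>\<^bsub>G\<^esub> (y \<otimes>\<^bsub>G\<^esub> z))" and \<xi>g: "\<xi> \<otimes> \<xi>\<^sup>\<star> = g"
    using ranges_rep[OF gxyz] by blast
  note [simp] = reps_closed[OF \<eta>] reps_closed[OF \<xi>]
  \<comment> \<open>\<open>\<eta>\<close> and \<open>r v\<close> have the same image in
    \<open>G\<close> and the same range, so \<open>\<zeta>\<close>, which is fitted to follow
    \<open>v\<close>, can follow \<open>\<eta>\<close> as well.\<close>
  have "\<eta>\<^sup>\<star> \<otimes> \<eta> = (r \<otimes> v)\<^sup>\<star> \<otimes> (r \<otimes> v)"
    by (rule range_eq_imp_domain_eq)
      (use \<eta>g grv in \<open>simp_all add: j_reps[OF r] j_reps[OF v] j_reps[OF \<eta>] del: star_mult m_assoc\<close>)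
  also have "\<dots> = v\<^sup>\<star> \<otimes> ((r\<^sup>\<star> \<otimes> r) \<otimes> v)"
    by simp
  also have "\<dots> = v\<^sup>\<star> \<otimes> v"
    unfolding rd by (simp flip: ve)
  finally have \<eta>v: "\<eta>\<^sup>\<star> \<otimes> \<eta> = v\<^sup>\<star> \<otimes> v" .
  have oxyz: "om x (y \<otimes>\<^bsub>G\<^esub> z) g = r \<otimes> (q \<otimes> \<xi>\<^sup>\<star>)"
    by (rule om_eq[OF r q \<xi> g_def[symmetric] _ \<xi>g]) (simp add: rd qe)
  have oxy: "om x y g = r \<otimes> (v \<otimes> \<eta>\<^sup>\<star>)"
    by (rule om_eq[OF r v \<eta> g_def[symmetric] _ \<eta>g]) (simp add: rd ve)
  have oxy_z: "om (x \<otimes>\<^bsub>G\<^esub> y) z g = \<eta> \<otimes> (\<zeta> \<otimes> \<xi>\<^sup>\<star>)"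
    by (rule om_eq[OF \<eta> \<zeta> _ \<eta>g _ \<xi>g]) (use \<xi> in \<open>simp_all add: \<eta>v v\<zeta> G.m_assoc\<close>)
  note m = rmul_range[OF xyz(2,3) s(2,3)]
  have ms: "rmul y z s = s \<otimes> (v \<otimes> (\<zeta> \<otimes> q\<^sup>\<star>))"
    unfolding rmul_def e_def[symmetric] oyz by simp
  have rm: "r\<^sup>\<star> \<otimes> (r \<otimes> rmul y z s) = rmul y z s"
    using arg_cong[OF rs, of "\<lambda>w. w \<otimes> (v \<otimes> (\<zeta> \<otimes> q\<^sup>\<star>))"] by (simp add: ms)
  have t1: "th x (rmul y z s) = r \<otimes> (rmul y z s \<otimes> r\<^sup>\<star>)"
    by (rule th_eq[OF r m(1,2) rm])
  have "th x (rmul y z s) \<otimes> (th x (rmul y z s))\<^sup>\<star> = r \<otimes> (rmul y z s \<otimes> (r\<^sup>\<star> \<otimes> r) \<otimes> (rmul y z s)\<^sup>\<star>) \<otimes> r\<^sup>\<star>"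
    unfolding t1 using m(1) by simp
  also have "rmul y z s \<otimes> (r\<^sup>\<star> \<otimes> r) = (r\<^sup>\<star> \<otimes> r) \<otimes> rmul y z s"
    using m(1,2) by (intro idem_central[symmetric]) simp_all
  also have "\<dots> = rmul y z s"
    using rm m(1) by simp
  also have "rmul y z s \<otimes> (rmul y z s)\<^sup>\<star> = e"
    by (simp add: m(3) e_def)
  also have "r \<otimes> e \<otimes> r\<^sup>\<star> = g"
    using g by simp
  finally have t1g: "th x (rmul y z s) \<otimes> (th x (rmul y z s))\<^sup>\<star> = g" .
  have "rmul x (y \<otimes>\<^bsub>G\<^esub> z) (th x (rmul y z s)) = r \<otimes> (s \<otimes> (v \<otimes> (\<zeta> \<otimes> (q\<^sup>\<star> \<otimes> ((r\<^sup>\<star> \<otimes> r) \<otimes> q))))) \<otimes> \<xi>\<^sup>\<star>"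
    unfolding rmul_def[of x] t1g oxyz unfolding t1 unfolding ms by simp
  also have "(r\<^sup>\<star> \<otimes> r) \<otimes> q = q"
    unfolding rd by (simp flip: qe)
  also have "\<zeta> \<otimes> (q\<^sup>\<star> \<otimes> q) = \<zeta>"
    unfolding q\<zeta> by simp
  finally have L: "rmul x (y \<otimes>\<^bsub>G\<^esub> z) (th x (rmul y z s)) = r \<otimes> (s \<otimes> (v \<otimes> \<zeta>)) \<otimes> \<xi>\<^sup>\<star>" .
  have tx: "th x s \<in> kdom x" "th x s \<in> kdom (x \<otimes>\<^bsub>G\<^esub> y)"
    using th_image[OF xyz(1,2)] s(1,2) by blast+
  have rg: "rmul x y (th x s) \<otimes> (rmul x y (th x s))\<^sup>\<star> = g"
    using rmul_range(3)[OF xyz(1,2) tx] tr(2) g_def by simp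
  have txg: "th x s \<otimes> (th x s)\<^sup>\<star> = g"
    using tr(2) g_def by simp
  have "rmul (x \<otimes>\<^bsub>G\<^esub> y) z (rmul x y (th x s)) = r \<otimes> (s \<otimes> (r\<^sup>\<star> \<otimes> r) \<otimes> (v \<otimes> ((\<eta>\<^sup>\<star> \<otimes> \<eta>) \<otimes> \<zeta>))) \<otimes> \<xi>\<^sup>\<star>"
    unfolding rmul_def[of "x \<otimes>\<^bsub>G\<^esub> y"] rg oxy_z unfolding rmul_def txg oxy unfolding tr(1) by simp
  also have "s \<otimes> (r\<^sup>\<star> \<otimes> r) = s"
    unfolding rd by (rule es)
  also have "(\<eta>\<^sup>\<star> \<otimes> \<eta>) \<otimes> \<zeta> = \<zeta>"
    unfolding \<eta>v v\<zeta> by simp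
  finally show ?thesis
    using L by simp
qed

text \<open>The left-hand side is the first coordinate of the product of \<open>a \<delta>\<^bsub>j(u)\<^esub>\<close> and \<open>b \<delta>\<^bsub>j(v)\<^esub>\<close> in the
  crossed product.\<close>

lemma rmul_th_\<tau>:
  assumes [simp]: "u \<in> carrier U" "v \<in> carrier U"
  defines "a \<equiv> u \<otimes> (\<tau> u)\<^sup>\<star>" and "b \<equiv> v \<otimes> (\<tau> v)\<^sup>\<star>"
  shows "rmul (j u) (j v) (th (j u) ((\<tau> u)\<^sup>\<star> \<otimes> (a \<otimes> \<tau> u) \<otimes> b)) = u \<otimes> v \<otimes> (\<tau> (u \<otimes> v))\<^sup>\<star>"
proof -
  define r s q where "r = \<tau> u" "s = \<tau> v" "q = \<tau> (u \<otimes> v)"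
  note rsq = r_s_q_def
  have r: "r \<in> reps (j u)" and s: "s \<in> reps (j v)" and q: "q \<in> reps (j u \<otimes>\<^bsub>G\<^esub> j v)"
    by (simp_all add: rsq \<tau>_reps)
  note [simp] = reps_closed[OF r] reps_closed[OF s] reps_closed[OF q]
  have rr: "r \<otimes> r\<^sup>\<star> = u \<otimes> u\<^sup>\<star>" and ss: "s \<otimes> s\<^sup>\<star> = v \<otimes> v\<^sup>\<star>"
    by (simp_all add: rsq \<tau>_range)
  have rd: "r\<^sup>\<star> \<otimes> r = u\<^sup>\<star> \<otimes> u" and sd: "s\<^sup>\<star> \<otimes> s = v\<^sup>\<star> \<otimes> v"
    using rr ss by (simp_all add: range_eq_imp_domain_eq rsq)
  have b: "b = v \<otimes> s\<^sup>\<star>" and [simp]: "b \<in> carrier U" and jb [simp]: "j b = \<one>\<^bsub>G\<^esub>"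
    by (simp_all add: b_def rsq)
  have ar: "a \<otimes> r = u"
    by (simp add: a_def rd flip: rsq)
  have bs: "b \<otimes> s = v"
    by (simp add: b sd)
  have bb: "b \<otimes> b\<^sup>\<star> = v \<otimes> v\<^sup>\<star>"
  proof -
    have "b \<otimes> b\<^sup>\<star> = v \<otimes> (s\<^sup>\<star> \<otimes> s) \<otimes> v\<^sup>\<star>"
      by (simp add: b)
    then show ?thesis
      by (simp add: sd)
  qed
  have br: "b \<otimes> (r\<^sup>\<star> \<otimes> r) = (r\<^sup>\<star> \<otimes> r) \<otimes> b"
    by (rule idem_central[symmetric]) simp_all
  have ur: "u \<otimes> (r\<^sup>\<star> \<otimes> r) = u"
    by (simp add: rd)
  have ubr: "u \<otimes> (b \<otimes> (r\<^sup>\<star> \<otimes> r)) = u \<otimes> b"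
    unfolding br using mult_eq_assoc[OF ur, of b] by simp
  define m where "m = u \<otimes> (b \<otimes> r\<^sup>\<star>)"
  \<comment> \<open>The range of \<open>u v\<close> may be smaller than that of \<open>u\<close>.
    The twist is taken at this smaller idempotent, since it is the range of
    \<open>m\<close>.\<close>
  define e where "e = u \<otimes> v \<otimes> (u \<otimes> v)\<^sup>\<star>"
  have [simp]: "m \<in> carrier U" "e \<in> idems U"
    by (simp_all add: m_def e_def del: star_mult m_assoc)
  have jm: "j m = \<one>\<^bsub>G\<^esub>"
    by (simp add: m_def j_reps[OF r])
  have "m \<otimes> m\<^sup>\<star> = u \<otimes> (b \<otimes> (r\<^sup>\<star> \<otimes> r)) \<otimes> (b\<^sup>\<star> \<otimes> u\<^sup>\<star>)"
    by (simp add: m_def)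
  also have "\<dots> = u \<otimes> (b \<otimes> b\<^sup>\<star>) \<otimes> u\<^sup>\<star>"
    unfolding ubr by simp
  also have "\<dots> = e"
    unfolding bb by (simp add: e_def)
  finally have me: "m \<otimes> m\<^sup>\<star> = e" .
  have "th (j u) (r\<^sup>\<star> \<otimes> (u \<otimes> b)) = r \<otimes> ((r\<^sup>\<star> \<otimes> (u \<otimes> b)) \<otimes> r\<^sup>\<star>)"
    by (rule th_eq[OF r]) (simp_all add: j_reps[OF r])
  also have "\<dots> = m"
    using mult_eq_mult_assoc[OF rr, of "u \<otimes> (b \<otimes> r\<^sup>\<star>)"] by (simp add: m_def)
  finally have th: "th (j u) (r\<^sup>\<star> \<otimes> (a \<otimes> r) \<otimes> b) = m"
    by (simp add: ar)
  \<comment> \<open>\<open>g\<close> is \<open>e\<close> moved across \<open>r\<close>. Written as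
    the range of \<open>c v\<close> with \<open>c\<close> in the kernel, it is seen to lie below
    \<open>v v\<^sup>\<star>\<close>, so that \<open>g s\<close> has range exactly
    \<open>g\<close>.\<close>
  define c g where "c = r\<^sup>\<star> \<otimes> u" "g = r\<^sup>\<star> \<otimes> (e \<otimes> r)"
  have [simp]: "c \<in> carrier U" "j c = \<one>\<^bsub>G\<^esub>" "g \<in> idems U"
    using conj_idem[of "r\<^sup>\<star>" e] by (simp_all add: c_g_def j_reps[OF r])
  have "g = (c \<otimes> v) \<otimes> (c \<otimes> v)\<^sup>\<star>"
    by (simp add: c_g_def e_def)
  also have "\<dots> = (c \<otimes> c\<^sup>\<star>) \<otimes> (v \<otimes> v\<^sup>\<star>)"
    by (rule kernel_range_mult) simp_all
  finally have gv: "g \<otimes> (v \<otimes> v\<^sup>\<star>) = g"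
    by simp
  have om: "om (j u) (j v) e = e \<otimes> r \<otimes> ((g \<otimes> s) \<otimes> q\<^sup>\<star>)"
  proof (rule om_eq)
    show "e \<otimes> r \<in> reps (j u)" "g \<otimes> s \<in> reps (j v)" "q \<in> reps (j u \<otimes>\<^bsub>G\<^esub> j v)"
      using r s q by (simp_all add: reps_idem_mult)
    have "e \<otimes> r \<otimes> (e \<otimes> r)\<^sup>\<star> = e \<otimes> (u \<otimes> u\<^sup>\<star>)"
      using kernel_range_mult[of e r] rr by simp
    then show "e \<otimes> r \<otimes> (e \<otimes> r)\<^sup>\<star> = e"
      by (simp add: e_def)
    show "q \<otimes> q\<^sup>\<star> = e"
      by (simp add: rsq \<tau>_range e_def del: star_mult m_assoc)
    have "g \<otimes> s \<otimes> (g \<otimes> s)\<^sup>\<star> = g \<otimes> (v \<otimes> v\<^sup>\<star>)"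
      using kernel_range_mult[of g s] ss by simp
    then show "(e \<otimes> r)\<^sup>\<star> \<otimes> (e \<otimes> r) = g \<otimes> s \<otimes> (g \<otimes> s)\<^sup>\<star>"
      unfolding gv by (simp add: c_g_def)
  qed
  have rg: "r \<otimes> g = e \<otimes> r"
    using idem_left_comm[of "r \<otimes> r\<^sup>\<star>" e r] by (simp add: c_g_def)
  have em: "m \<otimes> e = m"
    using idem_central[of e m] jm by (simp flip: me)
  have "rmul (j u) (j v) m = (m \<otimes> e) \<otimes> (r \<otimes> g) \<otimes> (s \<otimes> q\<^sup>\<star>)"
    by (simp add: rmul_def me om)
  also have "\<dots> = (m \<otimes> e) \<otimes> (r \<otimes> (s \<otimes> q\<^sup>\<star>))"
    unfolding rg by simp
  also have "\<dots> = u \<otimes> (b \<otimes> (r\<^sup>\<star> \<otimes> r)) \<otimes> (s \<otimes> q\<^sup>\<star>)"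
    unfolding em by (simp add: m_def)
  also have "\<dots> = u \<otimes> (b \<otimes> s) \<otimes> q\<^sup>\<star>"
    unfolding ubr by simp
  finally show ?thesis
    using th by (simp add: bs flip: rsq)
qed

end

section \<open>The crossed product\<close>

context inv_sgrp
begin

text \<open>The factorization \<open>a = a (a\<^sup>\<star> a)\<close> puts every common element
  into the product. Conditions on products of the domains thereby become conditions on
  intersections.\<close>

lemma setmult_ideals:
  assumes I: "sg_ideal U I" and J: "sg_ideal U J"
  shows "setmult U I J = I \<inter> J"
proof (intro equalityI subsetI)
  fix a assume "a \<in> setmult U I J"
  then show "a \<in> I \<inter> J"
    using I J unfolding setmult_def sg_ideal_def by blast
next
  fix a assume a: "a \<in> I \<inter> J"
  then have [simp]: "a \<in> carrier U"
    using I unfolding sg_ideal_def by blast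
  have "a\<^sup>\<star> \<otimes> a \<in> J"
    using a J unfolding sg_ideal_def by simp
  moreover have "a = a \<otimes> (a\<^sup>\<star> \<otimes> a)"
    by simp
  ultimately show "a \<in> setmult U I J"
    using a unfolding setmult_def by blast
qed

lemma sg_ideal_Int:
  assumes I: "sg_ideal U I" and J: "sg_ideal U J"
  shows "sg_ideal U (I \<inter> J)"
proof -
  have "setmult U I J \<noteq> {}"
    using I J unfolding sg_ideal_def setmult_def by blast
  then show ?thesis
    using I J unfolding setmult_ideals[OF assms] sg_ideal_def by blast
qed

end

section \<open>Families of kernel units that induce invertible multipliers\<close>

context tau_ext
begin

text \<open>For each \<open>e\<close> in a downward closed set of idempotents, \<open>m e\<close> is
  a unit of the maximal subgroup of the kernel at \<open>e\<close>, compatibly with restriction.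
  Such a family stands in for an invertible multiplier of the ideal of kernel elements with range in
  \<open>E\<close>.\<close>

definition unit_family :: "'u set \<Rightarrow> ('u \<Rightarrow> 'u) \<Rightarrow> bool" where
  "unit_family E m \<longleftrightarrow> E \<subseteq> idems U \<and> (\<forall>e\<in>E. m e \<in> carrier U \<and> j (m e) = \<one>\<^bsub>G\<^esub> \<and> m e \<otimes> (m e)\<^sup>\<star> = e \<and>
     (\<forall>f\<in>idems U. f \<otimes> e \<in> E \<and> m (f \<otimes> e) = f \<otimes> m e))"

lemma unit_familyD:
  assumes "unit_family E m" "e \<in> E"
  shows "e \<in> idems U" "m e \<in> carrier U" "j (m e) = \<one>\<^bsub>G\<^esub>" "m e \<otimes> (m e)\<^sup>\<star> = e" "(m e)\<^sup>\<star> \<otimes> m e = e"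
    "f \<in> idems U \<Longrightarrow> f \<otimes> e \<in> E" "f \<in> idems U \<Longrightarrow> m (f \<otimes> e) = f \<otimes> m e"
  using assms kernel_range_eq_domain[of "m e"] unfolding unit_family_def by auto

lemma unit_family_star:
  assumes "unit_family E m"
  shows "unit_family E (\<lambda>e. (m e)\<^sup>\<star>)"
proof -
  have "(f \<otimes> m e)\<^sup>\<star> = f \<otimes> (m e)\<^sup>\<star>" if "e \<in> E" "f \<in> idems U" for e f
    using unit_familyD[OF assms that(1)] that(2) idem_central[of f "(m e)\<^sup>\<star>"] by simp
  then show ?thesis
    using assms unit_familyD[OF assms] unfolding unit_family_def by simp
qed

lemma unit_family_om:
  assumes "x \<in> carrier G" "y \<in> carrier G"
  shows "unit_family (ranges x \<inter> ranges (x \<otimes>\<^bsub>G\<^esub> y)) (om x y)"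
  unfolding unit_family_def using om_kernel[OF assms] ranges_idem_mult by auto

lemma unit_family_range:
  assumes m: "unit_family E m" and [simp]: "a \<in> carrier U" and [simp]: "j a = \<one>\<^bsub>G\<^esub>" and e: "a \<otimes> a\<^sup>\<star> \<in> E"
  shows "m (a \<otimes> a\<^sup>\<star>) \<otimes> a \<otimes> (m (a \<otimes> a\<^sup>\<star>) \<otimes> a)\<^sup>\<star> = a \<otimes> a\<^sup>\<star>"
    "a \<otimes> m (a \<otimes> a\<^sup>\<star>) \<otimes> (a \<otimes> m (a \<otimes> a\<^sup>\<star>))\<^sup>\<star> = a \<otimes> a\<^sup>\<star>"
  using unit_familyD(2-4)[OF m e] kernel_range_mult[of "m (a \<otimes> a\<^sup>\<star>)" a]
    kernel_range_mult[of a "m (a \<otimes> a\<^sup>\<star>)"] by simp_all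

text \<open>At the range \<open>e f\<close> of \<open>s t\<close> the value of the family reads both
  as \<open>e\<close> times \<open>m f\<close> and as \<open>f\<close> times \<open>m e\<close>.
  With the reading that suits the factor to be kept, the extra idempotent moves past kernel elements
  and is absorbed by \<open>s\<close> or \<open>t\<close>. The last three claims are the multiplier
  identities.\<close>

lemma unit_family_mult:
  assumes m: "unit_family E m"
    and s [simp]: "s \<in> carrier U" and js [simp]: "j s = \<one>\<^bsub>G\<^esub>" and se: "s \<otimes> s\<^sup>\<star> \<in> E"
    and t [simp]: "t \<in> carrier U" and jt [simp]: "j t = \<one>\<^bsub>G\<^esub>" and te: "t \<otimes> t\<^sup>\<star> \<in> E"
  shows "s \<otimes> t \<otimes> (s \<otimes> t)\<^sup>\<star> \<in> E"
    "m (s \<otimes> t \<otimes> (s \<otimes> t)\<^sup>\<star>) \<otimes> (s \<otimes> t) = m (s \<otimes> s\<^sup>\<star>) \<otimes> s \<otimes> t"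
    "(s \<otimes> t) \<otimes> m (s \<otimes> t \<otimes> (s \<otimes> t)\<^sup>\<star>) = s \<otimes> (t \<otimes> m (t \<otimes> t\<^sup>\<star>))"
    "s \<otimes> (m (t \<otimes> t\<^sup>\<star>) \<otimes> t) = (s \<otimes> m (s \<otimes> s\<^sup>\<star>)) \<otimes> t"
proof -
  define e f where "e = s \<otimes> s\<^sup>\<star>" "f = t \<otimes> t\<^sup>\<star>"
  have E: "e \<in> E" "f \<in> E" and [simp]: "e \<in> idems U" "f \<in> idems U"
    using se te by (simp_all add: e_f_def)
  note [simp] = unit_familyD(2,3)[OF m E(1)] unit_familyD(2,3)[OF m E(2)]
  have st: "s \<otimes> t \<otimes> (s \<otimes> t)\<^sup>\<star> = e \<otimes> f"
    unfolding e_f_def by (rule kernel_range_mult) simp_all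
  have m1: "m (e \<otimes> f) = e \<otimes> m f"
    by (rule unit_familyD(7)[OF m E(2)]) simp
  have m2: "m (e \<otimes> f) = f \<otimes> m e"
    using unit_familyD(7)[OF m E(1), of f] idem_comm[of e f] by simp
  have es: "s \<otimes> e = s" and ft: "f \<otimes> t = t"
    using idem_central[of e s] by (simp_all add: e_f_def)
  have et: "t \<otimes> e = e \<otimes> t" and fs: "f \<otimes> s = s \<otimes> f" and fm: "f \<otimes> m e = m e \<otimes> f"
    using idem_central[of e t] idem_central[of f s] idem_central[of f "m e"] by simp_all
  show "s \<otimes> t \<otimes> (s \<otimes> t)\<^sup>\<star> \<in> E"
    unfolding st by (rule unit_familyD(6)[OF m E(2)]) simp
  have "m (e \<otimes> f) \<otimes> (s \<otimes> t) = m e \<otimes> ((f \<otimes> s) \<otimes> t)"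
    unfolding m2 fm by simp
  also have "\<dots> = m e \<otimes> (s \<otimes> (f \<otimes> t))"
    unfolding fs by simp
  finally show "m (s \<otimes> t \<otimes> (s \<otimes> t)\<^sup>\<star>) \<otimes> (s \<otimes> t) = m (s \<otimes> s\<^sup>\<star>) \<otimes> s \<otimes> t"
    unfolding st e_f_def[symmetric] ft by simp
  have "(s \<otimes> t) \<otimes> m (e \<otimes> f) = s \<otimes> ((t \<otimes> e) \<otimes> m f)"
    unfolding m1 by simp
  also have "\<dots> = (s \<otimes> e) \<otimes> (t \<otimes> m f)"
    unfolding et by simp
  finally show "(s \<otimes> t) \<otimes> m (s \<otimes> t \<otimes> (s \<otimes> t)\<^sup>\<star>) = s \<otimes> (t \<otimes> m (t \<otimes> t\<^sup>\<star>))"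
    unfolding st e_f_def[symmetric] es by simp
  have "s \<otimes> (m f \<otimes> t) = (s \<otimes> e) \<otimes> (m f \<otimes> t)"
    unfolding es by simp
  also have "\<dots> = s \<otimes> (m (e \<otimes> f) \<otimes> t)"
    unfolding m1 by simp
  also have "\<dots> = s \<otimes> (m e \<otimes> (f \<otimes> t))"
    unfolding m2 fm by simp
  finally show "s \<otimes> (m (t \<otimes> t\<^sup>\<star>) \<otimes> t) = (s \<otimes> m (s \<otimes> s\<^sup>\<star>)) \<otimes> t"
    unfolding ft e_f_def[symmetric] by simp
qed

end

section \<open>Transfer from the kernel to \<open>A\<close>\<close>

locale kernel_ext = tau_ext U G j \<tau> + A: inv_sgrp A
  for U :: "('u, 'b) monoid_scheme" (structure) and G :: "('g, 'c) monoid_scheme"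
    and j :: "'u \<Rightarrow> 'g" and \<tau> :: "'u \<Rightarrow> 'u" and A :: "('a, 'd) monoid_scheme" +
  fixes i :: "'a \<Rightarrow> 'u"
  assumes i_mono: "sg_mono A U i"
    and i_image: "i ` carrier A = {u \<in> carrier U. j u = \<one>\<^bsub>G\<^esub>}"
begin

lemma i_closed [simp]: "a \<in> carrier A \<Longrightarrow> i a \<in> carrier U"
  and j_i [simp]: "a \<in> carrier A \<Longrightarrow> j (i a) = \<one>\<^bsub>G\<^esub>"
  using i_image by auto

lemma i_mult [simp]: "a \<in> carrier A \<Longrightarrow> b \<in> carrier A \<Longrightarrow> i (a \<otimes>\<^bsub>A\<^esub> b) = i a \<otimes> i b"
  using i_mono by (simp add: sg_mono_def sg_hom_def)

lemma i_inj: "a \<in> carrier A \<Longrightarrow> b \<in> carrier A \<Longrightarrow> i a = i b \<Longrightarrow> a = b"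
  using i_mono by (auto simp: sg_mono_def inj_on_def)

definition pull :: "'u \<Rightarrow> 'a" where
  "pull = inv_into (carrier A) i"

lemma pull_closed [simp]: "u \<in> carrier U \<Longrightarrow> j u = \<one>\<^bsub>G\<^esub> \<Longrightarrow> pull u \<in> carrier A"
  and i_pull [simp]: "u \<in> carrier U \<Longrightarrow> j u = \<one>\<^bsub>G\<^esub> \<Longrightarrow> i (pull u) = u"
  unfolding pull_def using i_image by (auto intro: inv_into_into f_inv_into_f)

lemma pull_i [simp]: "a \<in> carrier A \<Longrightarrow> pull (i a) = a"
  by (rule i_inj) simp_all

definition family_mult :: "('u \<Rightarrow> 'u) \<Rightarrow> ('a \<Rightarrow> 'a) \<times> ('a \<Rightarrow> 'a)" where
  "family_mult m = (\<lambda>a. pull (m (i a \<otimes> (i a)\<^sup>\<star>) \<otimes> i a), \<lambda>a. pull (i a \<otimes> m (i a \<otimes> (i a)\<^sup>\<star>)))"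

lemma family_mult_closed:
  assumes m: "unit_family E m" and a [simp]: "a \<in> carrier A" and e: "i a \<otimes> (i a)\<^sup>\<star> \<in> E"
  shows "fst (family_mult m) a \<in> carrier A" "snd (family_mult m) a \<in> carrier A"
    "i (fst (family_mult m) a) = m (i a \<otimes> (i a)\<^sup>\<star>) \<otimes> i a"
    "i (snd (family_mult m) a) = i a \<otimes> m (i a \<otimes> (i a)\<^sup>\<star>)"
  using unit_familyD(2,3)[OF m e] by (simp_all add: family_mult_def)

lemma is_multiplier_family_mult:
  assumes m: "unit_family E m"
  shows "is_multiplier A {a \<in> carrier A. i a \<otimes> (i a)\<^sup>\<star> \<in> E} (family_mult m)"
proof -
  note c = family_mult_closed[OF m]
  have closed: "fst (family_mult m) a \<in> {a \<in> carrier A. i a \<otimes> (i a)\<^sup>\<star> \<in> E}"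
      "snd (family_mult m) a \<in> {a \<in> carrier A. i a \<otimes> (i a)\<^sup>\<star> \<in> E}"
    if "a \<in> carrier A" "i a \<otimes> (i a)\<^sup>\<star> \<in> E" for a
    using c[OF that] unit_family_range[OF m, of "i a"] that by (simp_all del: star_mult m_assoc)
  have "fst (family_mult m) (s \<otimes>\<^bsub>A\<^esub> t) = fst (family_mult m) s \<otimes>\<^bsub>A\<^esub> t \<and>
      snd (family_mult m) (s \<otimes>\<^bsub>A\<^esub> t) = s \<otimes>\<^bsub>A\<^esub> snd (family_mult m) t \<and>
      s \<otimes>\<^bsub>A\<^esub> fst (family_mult m) t = snd (family_mult m) s \<otimes>\<^bsub>A\<^esub> t"
    if s: "s \<in> carrier A" "i s \<otimes> (i s)\<^sup>\<star> \<in> E" and t: "t \<in> carrier A" "i t \<otimes> (i t)\<^sup>\<star> \<in> E" for s t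
  proof -
    note u = unit_family_mult[OF m i_closed[OF s(1)] j_i[OF s(1)] s(2) i_closed[OF t(1)] j_i[OF t(1)] t(2)]
    have st: "s \<otimes>\<^bsub>A\<^esub> t \<in> carrier A" "i (s \<otimes>\<^bsub>A\<^esub> t) \<otimes> (i (s \<otimes>\<^bsub>A\<^esub> t))\<^sup>\<star> \<in> E"
      using s t u(1) by simp_all
    note mc = unit_familyD(2)[OF m s(2)] unit_familyD(2)[OF m t(2)]
    show ?thesis
      by (intro conjI; rule i_inj) (use s(1) t(1) c[OF s] c[OF t] c[OF st] u(2-4) mc in \<open>simp_all\<close>)
  qed
  then show ?thesis
    unfolding is_multiplier_def using closed by blast
qed

lemma family_mult_inverse:
  assumes m: "unit_family E m" and m': "unit_family E m'"
    and inv: "\<And>e. e \<in> E \<Longrightarrow> m e \<otimes> m' e = e" "\<And>e. e \<in> E \<Longrightarrow> m' e \<otimes> m e = e"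
    and a [simp]: "a \<in> carrier A" and e: "i a \<otimes> (i a)\<^sup>\<star> \<in> E"
  shows "fst (family_mult m) (fst (family_mult m') a) = a" "snd (family_mult m) (snd (family_mult m') a) = a"
proof -
  note c = family_mult_closed[OF m' a e]
  note r = unit_family_range[OF m' i_closed[OF a] j_i[OF a] e]
  note M = unit_familyD(2)[OF m e] unit_familyD(2)[OF m' e]
  \<comment> \<open>The first multiplication preserves the range, so the second evaluates its family
    at the same idempotent and the two values meet there.\<close>
  have r1: "i (fst (family_mult m') a) \<otimes> (i (fst (family_mult m') a))\<^sup>\<star> = i a \<otimes> (i a)\<^sup>\<star>"
    unfolding c(3) by (rule r(1))
  have r2: "i (snd (family_mult m') a) \<otimes> (i (snd (family_mult m') a))\<^sup>\<star> = i a \<otimes> (i a)\<^sup>\<star>"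
    unfolding c(4) by (rule r(2))
  note c1 = family_mult_closed[OF m c(1), unfolded r1, OF e]
  note c2 = family_mult_closed[OF m c(2), unfolded r2, OF e]
  have ae: "i a \<otimes> (i a \<otimes> (i a)\<^sup>\<star>) = i a"
    using idem_central[of "i a \<otimes> (i a)\<^sup>\<star>" "i a"] by simp
  show "fst (family_mult m) (fst (family_mult m') a) = a"
  proof (rule i_inj)
    have "i (fst (family_mult m) (fst (family_mult m') a)) =
        (m (i a \<otimes> (i a)\<^sup>\<star>) \<otimes> m' (i a \<otimes> (i a)\<^sup>\<star>)) \<otimes> i a"
      unfolding c1(3) unfolding c(3) using M by simp
    then show "i (fst (family_mult m) (fst (family_mult m') a)) = i a"
      unfolding inv(1)[OF e] by simp
  qed (use c1 in simp_all)
  show "snd (family_mult m) (snd (family_mult m') a) = a"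
  proof (rule i_inj)
    have "i (snd (family_mult m) (snd (family_mult m') a)) =
        i a \<otimes> (m' (i a \<otimes> (i a)\<^sup>\<star>) \<otimes> m (i a \<otimes> (i a)\<^sup>\<star>))"
      unfolding c2(4) unfolding c(4) using M by simp
    then show "i (snd (family_mult m) (snd (family_mult m') a)) = i a"
      unfolding inv(2)[OF e] ae .
  qed (use c2 in simp_all)
qed

text \<open>The inverse multiplier is induced by the family of inverses, each of which inverts
  \<open>m e\<close> in the subgroup at \<open>e\<close>.\<close>

lemma unit_multiplier_family_mult:
  assumes m: "unit_family E m"
  shows "unit_multiplier A {a \<in> carrier A. i a \<otimes> (i a)\<^sup>\<star> \<in> E} (family_mult m)"
  unfolding unit_multiplier_def
proof (intro conjI exI[of _ "family_mult (\<lambda>e. (m e)\<^sup>\<star>)"] ballI)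
  show "is_multiplier A {a \<in> carrier A. i a \<otimes> (i a)\<^sup>\<star> \<in> E} (family_mult m)"
    "is_multiplier A {a \<in> carrier A. i a \<otimes> (i a)\<^sup>\<star> \<in> E} (family_mult (\<lambda>e. (m e)\<^sup>\<star>))"
    using m unit_family_star by (simp_all add: is_multiplier_family_mult)
qed (use family_mult_inverse[OF m unit_family_star[OF m]] family_mult_inverse[OF unit_family_star[OF m] m]
      unit_familyD(4,5)[OF m] in auto)

definition D :: "'g \<Rightarrow> 'a set" where
  "D x = {a \<in> carrier A. i a \<in> kdom x}"

definition \<theta> :: "'g \<Rightarrow> 'a \<Rightarrow> 'a" where
  "\<theta> x a = pull (th x (i a))"

definition w :: "'g \<Rightarrow> 'g \<Rightarrow> ('a \<Rightarrow> 'a) \<times> ('a \<Rightarrow> 'a)" where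
  "w x y = family_mult (om x y)"

lemma D_closed: "a \<in> D x \<Longrightarrow> a \<in> carrier A"
  and i_D: "a \<in> D x \<Longrightarrow> i a \<in> kdom x"
  unfolding D_def by simp_all

lemma pull_D: "u \<in> kdom x \<Longrightarrow> pull u \<in> D x"
  unfolding D_def using kdomD by simp

lemma i_\<theta>: "x \<in> carrier G \<Longrightarrow> a \<in> D (inv\<^bsub>G\<^esub> x) \<Longrightarrow> i (\<theta> x a) = th x (i a)"
  unfolding \<theta>_def using kdomD[OF th_dom] i_D by simp

lemma \<theta>_D: "x \<in> carrier G \<Longrightarrow> a \<in> D (inv\<^bsub>G\<^esub> x) \<Longrightarrow> \<theta> x a \<in> D x"
  unfolding \<theta>_def by (simp add: pull_D th_dom i_D)

lemma D_ideal:
  assumes x: "x \<in> carrier G"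
  shows "sg_ideal A (D x)"
proof -
  \<comment> \<open>Nonemptiness comes from \<open>j\<close> being onto: any \<open>u\<close> over
    \<open>x\<close> contributes its range idempotent.\<close>
  have "x \<in> j ` carrier U"
    using j_epi x by (simp add: sg_epi_def)
  then obtain u where u: "u \<in> carrier U" "j u = x"
    by blast
  then have "u \<otimes> u\<^sup>\<star> \<in> kdom x"
    using rangesI[OF u] j_idem[OF range_idem[OF u(1)]] unfolding kdom_def
    by (simp add: star_idem[OF range_idem[OF u(1)]] del: star_mult j_mult)
  then have "D x \<noteq> {}"
    using pull_D by blast
  moreover have "a \<otimes>\<^bsub>A\<^esub> t \<in> D x \<and> t \<otimes>\<^bsub>A\<^esub> a \<in> D x" if "a \<in> D x" "t \<in> carrier A" for a t
    using kdom_mult[OF i_D[OF that(1)] i_closed[OF that(2)] j_i[OF that(2)]] D_closed[OF that(1)] that(2)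
    unfolding D_def by simp
  ultimately show ?thesis
    using D_closed unfolding sg_ideal_def by blast
qed

lemma setmult_D:
  "x \<in> carrier G \<Longrightarrow> y \<in> carrier G \<Longrightarrow> setmult A (D x) (D y) = D x \<inter> D y"
  by (rule A.setmult_ideals) (simp_all add: D_ideal)

lemma D_Int: "D x \<inter> D y = {a \<in> carrier A. i a \<otimes> (i a)\<^sup>\<star> \<in> ranges x \<inter> ranges y}"
  unfolding D_def kdom_def by auto

lemma i_w:
  assumes "x \<in> carrier G" "y \<in> carrier G" "a \<in> D x" "a \<in> D (x \<otimes>\<^bsub>G\<^esub> y)"
  shows "i (fst (w x y) a) = lmul x y (i a)" "i (snd (w x y) a) = rmul x y (i a)"
    "snd (w x y) a \<in> D x \<inter> D (x \<otimes>\<^bsub>G\<^esub> y)"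
proof -
  have a: "a \<in> carrier A" "i a \<otimes> (i a)\<^sup>\<star> \<in> ranges x \<inter> ranges (x \<otimes>\<^bsub>G\<^esub> y)"
    using assms(3,4) unfolding D_def kdom_def by auto
  show "i (fst (w x y) a) = lmul x y (i a)" "i (snd (w x y) a) = rmul x y (i a)"
    using family_mult_closed[OF unit_family_om[OF assms(1,2)] a] by (simp_all add: w_def lmul_def rmul_def)
  show "snd (w x y) a \<in> D x \<inter> D (x \<otimes>\<^bsub>G\<^esub> y)"
    using is_multiplier_family_mult[OF unit_family_om[OF assms(1,2)]] assms(3,4)
    unfolding is_multiplier_def w_def[symmetric] D_Int[symmetric] by blast
qed

lemma unit_multiplier_w:
  "x \<in> carrier G \<Longrightarrow> y \<in> carrier G \<Longrightarrow> unit_multiplier A (D x \<inter> D (x \<otimes>\<^bsub>G\<^esub> y)) (w x y)"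
  unfolding w_def D_Int by (rule unit_multiplier_family_mult[OF unit_family_om])

text \<open>\<open>mult_inv\<close> is built from \<open>inv_into\<close>, and injectivity on this
  domain is what makes \<open>inv_into\<close> undo \<open>snd (w x y)\<close> there.\<close>

lemma snd_w_inj:
  assumes "x \<in> carrier G" "y \<in> carrier G"
  shows "inj_on (snd (w x y)) (D x \<inter> D (x \<otimes>\<^bsub>G\<^esub> y))"
proof -
  obtain w' :: "('a \<Rightarrow> 'a) \<times> ('a \<Rightarrow> 'a)" where "\<forall>s\<in>D x \<inter> D (x \<otimes>\<^bsub>G\<^esub> y). snd w' (snd (w x y) s) = s"
    using unit_multiplier_w[OF assms] unfolding unit_multiplier_def by blast
  then show ?thesis
    by (intro inj_on_inverseI[of _ "snd w'"]) blast
qed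

lemma \<theta>_bij:
  assumes x: "x \<in> carrier G"
  shows "bij_betw (\<theta> x) (D (inv\<^bsub>G\<^esub> x)) (D x)"
  unfolding bij_betw_def
proof (intro conjI equalityI subsetI)
  show "inj_on (\<theta> x) (D (inv\<^bsub>G\<^esub> x))"
  proof (rule inj_onI)
    fix a b assume a: "a \<in> D (inv\<^bsub>G\<^esub> x)" and b: "b \<in> D (inv\<^bsub>G\<^esub> x)" and "\<theta> x a = \<theta> x b"
    then have "th x (i a) = th x (i b)"
      using i_\<theta>[OF x a] i_\<theta>[OF x b] by simp
    then show "a = b"
      using th_inj[OF x i_D[OF a] i_D[OF b]] i_inj[OF D_closed[OF a] D_closed[OF b]] by simp
  qed
  show "a \<in> D x" if "a \<in> \<theta> x ` D (inv\<^bsub>G\<^esub> x)" for a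
    using that \<theta>_D[OF x] by blast
  show "a \<in> \<theta> x ` D (inv\<^bsub>G\<^esub> x)" if a: "a \<in> D x" for a
  proof -
    have "i a \<in> th x ` kdom (inv\<^bsub>G\<^esub> x)"
      using th_bij[OF x] i_D[OF a] by (simp add: bij_betw_def)
    then obtain b where b: "b \<in> kdom (inv\<^bsub>G\<^esub> x)" "i a = th x b"
      by blast
    then have "a = \<theta> x (pull b)"
      using kdomD[OF b(1)] D_closed[OF a] by (simp add: \<theta>_def flip: b(2))
    then show ?thesis
      using pull_D[OF b(1)] by blast
  qed
qed

text \<open>\<open>i\<close> and \<open>pull\<close> are mutually inverse between these
  intersections in \<open>A\<close> and in the kernel, so \<open>th_image\<close> carries
  over.\<close>

lemma \<theta>_image:
  assumes x: "x \<in> carrier G" and y: "y \<in> carrier G"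
  shows "\<theta> x ` (D (inv\<^bsub>G\<^esub> x) \<inter> D y) = D x \<inter> D (x \<otimes>\<^bsub>G\<^esub> y)"
proof -
  have i: "i ` (D x \<inter> D y) = kdom x \<inter> kdom y" for x y
    unfolding D_def using i_image by (auto simp: kdom_def)
  have p: "D x \<inter> D y = pull ` (kdom x \<inter> kdom y)" for x y
  proof -
    have "(\<lambda>a. pull (i a)) ` (D x \<inter> D y) = id ` (D x \<inter> D y)"
      by (rule image_cong) (auto simp: D_closed)
    then show ?thesis
      unfolding i[symmetric] image_image by simp
  qed
  have "\<theta> x ` (D (inv\<^bsub>G\<^esub> x) \<inter> D y) = pull ` th x ` i ` (D (inv\<^bsub>G\<^esub> x) \<inter> D y)"
    unfolding \<theta>_def image_image ..
  then show ?thesis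
    unfolding i th_image[OF assms] p[symmetric] .
qed

lemma twisted_partial_action: "twisted_partial_action G A D \<theta> w"
  unfolding twisted_partial_action_def
proof (intro conjI ballI)
  show "group G" ..
  show "sgrp A"
    using A.inverse_semigroup by (simp add: inverse_semigroup_def)
  fix x assume x [simp]: "x \<in> carrier G"
  show "sg_ideal A (D x)"
    by (simp add: D_ideal)
  show "bij_betw (\<theta> x) (D (inv\<^bsub>G\<^esub> x)) (D x)"
    by (simp add: \<theta>_bij)
  show "setmult A (D x) (D x) = D x"
    by (simp add: setmult_D)
  show "\<theta> x (a \<otimes>\<^bsub>A\<^esub> b) = \<theta> x a \<otimes>\<^bsub>A\<^esub> \<theta> x b" if a: "a \<in> D (inv\<^bsub>G\<^esub> x)" and b: "b \<in> D (inv\<^bsub>G\<^esub> x)" for a b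
  proof -
    have ab: "a \<otimes>\<^bsub>A\<^esub> b \<in> D (inv\<^bsub>G\<^esub> x)"
      using D_ideal[of "inv\<^bsub>G\<^esub> x"] a D_closed[OF b] unfolding sg_ideal_def by simp
    show ?thesis
      by (rule i_inj)
        (use a b ab th_mult[OF x i_D[OF a] i_D[OF b]] in
          \<open>simp_all add: i_\<theta> D_closed[OF \<theta>_D[OF x]] D_closed[OF a] D_closed[OF b]\<close>)
  qed
  show "fst (w \<one>\<^bsub>G\<^esub> x) s = s" "snd (w \<one>\<^bsub>G\<^esub> x) s = s" "fst (w x \<one>\<^bsub>G\<^esub>) s = s" "snd (w x \<one>\<^bsub>G\<^esub>) s = s"
    if s: "s \<in> D x" for s
    using om_one_left[OF kdomD(3)[OF i_D[OF s]]] om_one_right[OF kdomD(3)[OF i_D[OF s]]] D_closed[OF s]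
      idem_central[of "i s \<otimes> (i s)\<^sup>\<star>" "i s"]
    by (simp_all add: w_def family_mult_def)
  fix y assume y [simp]: "y \<in> carrier G"
  show "unit_multiplier A (setmult A (D x) (D (x \<otimes>\<^bsub>G\<^esub> y))) (w x y)"
    by (simp add: setmult_D unit_multiplier_w)
  show "setmult A (D x) (D y) = setmult A (D y) (D x)"
    by (simp add: setmult_D Int_commute)
  show "\<theta> x ` setmult A (D (inv\<^bsub>G\<^esub> x)) (D y) = setmult A (D x) (D (x \<otimes>\<^bsub>G\<^esub> y))"
    by (simp add: setmult_D \<theta>_image)
  show "\<theta> x (\<theta> y s) = snd (mult_inv (setmult A (D x) (D (x \<otimes>\<^bsub>G\<^esub> y))) (w x y))
      (fst (w x y) (\<theta> (x \<otimes>\<^bsub>G\<^esub> y) s))"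
    if "s \<in> setmult A (D (inv\<^bsub>G\<^esub> y)) (D (inv\<^bsub>G\<^esub> y \<otimes>\<^bsub>G\<^esub> inv\<^bsub>G\<^esub> x))" for s
  proof -
    have s: "s \<in> D (inv\<^bsub>G\<^esub> y)" "s \<in> D (inv\<^bsub>G\<^esub> y \<otimes>\<^bsub>G\<^esub> inv\<^bsub>G\<^esub> x)"
      using that by (simp_all add: setmult_D)
    have sxy: "s \<in> D (inv\<^bsub>G\<^esub> (x \<otimes>\<^bsub>G\<^esub> y))"
      using s by (simp add: G.inv_mult_group)
    have "\<theta> y s \<in> D y \<inter> D (y \<otimes>\<^bsub>G\<^esub> (inv\<^bsub>G\<^esub> y \<otimes>\<^bsub>G\<^esub> inv\<^bsub>G\<^esub> x))"
      using s by (subst \<theta>_image[symmetric]) auto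
    then have ys: "\<theta> y s \<in> D (inv\<^bsub>G\<^esub> x)"
      by (simp add: G.m_assoc[symmetric])
    note T = th_th[OF x y i_D[OF s(1)] i_D[OF s(2)]]
    have i1: "i (\<theta> x (\<theta> y s)) = th x (th y (i s))" and i2: "i (\<theta> (x \<otimes>\<^bsub>G\<^esub> y) s) = th (x \<otimes>\<^bsub>G\<^esub> y) (i s)"
      using s sxy ys by (simp_all add: i_\<theta>)
    have X1: "\<theta> x (\<theta> y s) \<in> D x \<inter> D (x \<otimes>\<^bsub>G\<^esub> y)"
      using T(1) D_closed[OF \<theta>_D[OF x ys]] by (simp add: D_def i1)
    have X2: "\<theta> (x \<otimes>\<^bsub>G\<^esub> y) s \<in> D x \<inter> D (x \<otimes>\<^bsub>G\<^esub> y)"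
      using T(2) D_closed[OF \<theta>_D[OF _ sxy]] by (simp add: D_def i2)
    have "fst (w x y) (\<theta> (x \<otimes>\<^bsub>G\<^esub> y) s) \<in> carrier A"
      using unit_multiplier_w[OF x y] X2 D_closed unfolding unit_multiplier_def is_multiplier_def by blast
    \<comment> \<open>Condition (iv) in its form without inverses; applying \<open>inv_into\<close>
      to both sides gives the required one.\<close>
    then have "snd (w x y) (\<theta> x (\<theta> y s)) = fst (w x y) (\<theta> (x \<otimes>\<^bsub>G\<^esub> y) s)"
      using X1 X2 T(3) i_w(3)[OF x y, of "\<theta> x (\<theta> y s)"] D_closed
      by (intro i_inj) (auto simp: i_w i1 i2)
    then show ?thesis
      using inv_into_f_f[OF snd_w_inj[OF x y] X1] by (simp add: mult_inv_def setmult_D)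
  qed
  fix z assume z [simp]: "z \<in> carrier G"
  show "snd (w x (y \<otimes>\<^bsub>G\<^esub> z)) (\<theta> x (snd (w y z) s)) = snd (w (x \<otimes>\<^bsub>G\<^esub> y) z) (snd (w x y) (\<theta> x s))"
    if "s \<in> setmult A (setmult A (D (inv\<^bsub>G\<^esub> x)) (D y)) (D (y \<otimes>\<^bsub>G\<^esub> z))" for s
  proof -
    have s: "s \<in> D (inv\<^bsub>G\<^esub> x)" "s \<in> D y" "s \<in> D (y \<otimes>\<^bsub>G\<^esub> z)"
      using that by (simp_all add: setmult_D A.setmult_ideals A.sg_ideal_Int D_ideal)
    \<comment> \<open>Right multiplication by the twist keeps the range idempotent, and membership
      of an element of \<open>A\<close> in \<open>D v\<close> depends on nothing else. So the
      product stays in every \<open>D v\<close> containing \<open>a\<close>.\<close>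
    have w_closed: "snd (w x' y') a \<in> D v"
      if "x' \<in> carrier G" "y' \<in> carrier G" "v \<in> carrier G" "a \<in> D x'" "a \<in> D (x' \<otimes>\<^bsub>G\<^esub> y')" "a \<in> D v" for x' y' v a
    proof -
      have "rmul x' y' (i a) \<otimes> (rmul x' y' (i a))\<^sup>\<star> = i a \<otimes> (i a)\<^sup>\<star>"
        using that by (intro rmul_range) (simp_all add: i_D)
      then show ?thesis
        using i_w(2,3)[OF that(1,2,4,5)] that(6) unfolding D_def kdom_def by auto
    qed
    have ws: "snd (w y z) s \<in> D (inv\<^bsub>G\<^esub> x)" "snd (w y z) s \<in> D (y \<otimes>\<^bsub>G\<^esub> z)"
      using s by (simp_all add: w_closed)
    have t1: "\<theta> x (snd (w y z) s) \<in> D x \<inter> D (x \<otimes>\<^bsub>G\<^esub> (y \<otimes>\<^bsub>G\<^esub> z))"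
      using ws by (subst \<theta>_image[symmetric]) auto
    have t2: "\<theta> x s \<in> D x \<inter> D (x \<otimes>\<^bsub>G\<^esub> y)" "\<theta> x s \<in> D x \<inter> D (x \<otimes>\<^bsub>G\<^esub> (y \<otimes>\<^bsub>G\<^esub> z))"
      using s by (subst \<theta>_image[symmetric]; auto)+
    have ws2: "snd (w x y) (\<theta> x s) \<in> D (x \<otimes>\<^bsub>G\<^esub> y)" "snd (w x y) (\<theta> x s) \<in> D (x \<otimes>\<^bsub>G\<^esub> y \<otimes>\<^bsub>G\<^esub> z)"
      using t2 by (simp_all add: w_closed G.m_assoc)
    have "snd (w x (y \<otimes>\<^bsub>G\<^esub> z)) (\<theta> x (snd (w y z) s)) \<in> D x" "snd (w (x \<otimes>\<^bsub>G\<^esub> y) z) (snd (w x y) (\<theta> x s)) \<in> D (x \<otimes>\<^bsub>G\<^esub> y)"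
      using t1 ws2 by (simp_all add: w_closed)
    moreover have "i (snd (w x (y \<otimes>\<^bsub>G\<^esub> z)) (\<theta> x (snd (w y z) s))) = rmul x (y \<otimes>\<^bsub>G\<^esub> z) (th x (rmul y z (i s)))"
      using t1 ws s by (simp add: i_w i_\<theta>)
    moreover have "i (snd (w (x \<otimes>\<^bsub>G\<^esub> y) z) (snd (w x y) (\<theta> x s))) = rmul (x \<otimes>\<^bsub>G\<^esub> y) z (rmul x y (th x (i s)))"
      using t2 ws2 s by (simp add: i_w i_\<theta>)
    ultimately show ?thesis
      using rmul_cocycle[OF x y z i_D[OF s(1)] i_D[OF s(2)] i_D[OF s(3)]] D_closed
      by (intro i_inj) auto
  qed
next
  show "D \<one>\<^bsub>G\<^esub> = carrier A"
    unfolding D_def kdom_def ranges_one by auto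
  have "th \<one>\<^bsub>G\<^esub> (i s) = i s" if s: "s \<in> carrier A" for s
  proof -
    \<comment> \<open>Over the identity, the range idempotent of \<open>i s\<close> serves as the
      conjugating representative.\<close>
    have "th \<one>\<^bsub>G\<^esub> (i s) = (i s \<otimes> (i s)\<^sup>\<star>) \<otimes> (i s \<otimes> (i s \<otimes> (i s)\<^sup>\<star>)\<^sup>\<star>)"
      using s by (intro th_eq) (simp_all add: reps_one)
    also have "\<dots> = i s"
      using s idem_central[of "i s \<otimes> (i s)\<^sup>\<star>" "i s"] by simp
    finally show ?thesis .
  qed
  then show "\<theta> \<one>\<^bsub>G\<^esub> s = s" if "s \<in> carrier A" for s
    using that by (simp add: \<theta>_def)
qed

section \<open>The equivalence with the crossed product\<close>

definition \<mu> :: "'u \<Rightarrow> 'a \<times> 'g" where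
  "\<mu> u = (pull (u \<otimes> (\<tau> u)\<^sup>\<star>), j u)"

lemma \<tau>_domain: "u \<in> carrier U \<Longrightarrow> (\<tau> u)\<^sup>\<star> \<otimes> \<tau> u = u\<^sup>\<star> \<otimes> u"
  by (rule range_eq_imp_domain_eq) (simp_all add: \<tau>_range)

lemma \<tau>_quotient_range:
  assumes [simp]: "u \<in> carrier U"
  shows "u \<otimes> (\<tau> u)\<^sup>\<star> \<otimes> (u \<otimes> (\<tau> u)\<^sup>\<star>)\<^sup>\<star> = u \<otimes> u\<^sup>\<star>"
proof -
  have "u \<otimes> (\<tau> u)\<^sup>\<star> \<otimes> (u \<otimes> (\<tau> u)\<^sup>\<star>)\<^sup>\<star> = u \<otimes> ((\<tau> u)\<^sup>\<star> \<otimes> \<tau> u) \<otimes> u\<^sup>\<star>"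
    by simp
  then show ?thesis
    by (simp add: \<tau>_domain)
qed

lemma \<tau>_quotient_dom:
  assumes [simp]: "u \<in> carrier U"
  shows "u \<otimes> (\<tau> u)\<^sup>\<star> \<in> kdom (j u)"
  using \<tau>_quotient_range[OF assms] rangesI[OF assms refl]
  by (intro kdomI) (simp_all del: star_mult m_assoc)

text \<open>For injectivity, the first coordinate fixes \<open>u u\<^sup>\<star>\<close>, which
  together with \<open>j u\<close> fixes \<open>\<tau> u\<close>; and \<open>u\<close> is the
  product of its quotient by \<open>\<tau> u\<close> with \<open>\<tau> u\<close>.\<close>

lemma \<mu>_bij: "bij_betw \<mu> (carrier U) (carrier (crossed_product A G D \<theta> w))"
  unfolding bij_betw_def
proof (intro conjI equalityI subsetI inj_onI)
  fix u v assume [simp]: "u \<in> carrier U" "v \<in> carrier U" and eq: "\<mu> u = \<mu> v"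
  then have jj: "j u = j v" and "i (pull (u \<otimes> (\<tau> u)\<^sup>\<star>)) = i (pull (v \<otimes> (\<tau> v)\<^sup>\<star>))"
    by (simp_all add: \<mu>_def)
  then have q: "u \<otimes> (\<tau> u)\<^sup>\<star> = v \<otimes> (\<tau> v)\<^sup>\<star>"
    by simp
  have t: "\<tau> u = \<tau> v"
    using \<tau>_quotient_range[of u] \<tau>_quotient_range[of v] q by (intro \<tau>_cong) (simp_all add: jj del: m_assoc star_mult)
  have c: "x \<otimes> (\<tau> x)\<^sup>\<star> \<otimes> \<tau> x = x" if "x \<in> carrier U" for x
    using that by (simp add: \<tau>_domain)
  show "u = v"
    using c[OF \<open>u \<in> carrier U\<close>] c[OF \<open>v \<in> carrier U\<close>] q t by metis
next
  fix p assume "p \<in> \<mu> ` carrier U"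
  then show "p \<in> carrier (crossed_product A G D \<theta> w)"
    using pull_D[OF \<tau>_quotient_dom] by (auto simp: crossed_product_def \<mu>_def)
next
  fix p assume "p \<in> carrier (crossed_product A G D \<theta> w)"
  then obtain a x where p: "p = (a, x)" and x: "x \<in> carrier G" and a: "a \<in> D x"
    by (auto simp: crossed_product_def)
  note [simp] = D_closed[OF a]
  obtain r where r: "r \<in> reps x" and ra: "r \<otimes> r\<^sup>\<star> = i a \<otimes> (i a)\<^sup>\<star>"
    using ranges_rep[OF kdomD(3)[OF i_D[OF a]]] by blast
  note [simp] = reps_closed[OF r]
  \<comment> \<open>Since \<open>r\<close> has the range of \<open>i a\<close>, applying
    \<open>\<tau>\<close> to this product returns \<open>r\<close>, and
    \<open>r r\<^sup>\<star>\<close> is absorbed by \<open>i a\<close>.\<close>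
  define u where "u = i a \<otimes> r"
  have [simp]: "u \<in> carrier U"
    by (simp add: u_def)
  have "\<tau> u = i a \<otimes> (i a)\<^sup>\<star> \<otimes> r"
    by (simp add: u_def \<tau>_mult \<tau>_of_reps[OF r])
  also have "\<dots> = r"
    by (simp flip: ra)
  finally have "u \<otimes> (\<tau> u)\<^sup>\<star> = i a \<otimes> (r \<otimes> r\<^sup>\<star>)"
    by (simp add: u_def)
  also have "\<dots> = i a"
    unfolding ra using idem_central[of "i a \<otimes> (i a)\<^sup>\<star>" "i a"] by simp
  finally have "\<mu> u = p"
    using x by (simp add: \<mu>_def p u_def j_reps[OF r])
  then show "p \<in> \<mu> ` carrier U"
    by (metis \<open>u \<in> carrier U\<close> imageI)
qed

lemma \<mu>_hom: "sg_hom U (crossed_product A G D \<theta> w) \<mu>"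
  unfolding sg_hom_def
proof (intro conjI ballI funcsetI)
  fix u assume "u \<in> carrier U"
  then show "\<mu> u \<in> carrier (crossed_product A G D \<theta> w)"
    using bij_betwE[OF \<mu>_bij] by blast
next
  fix u v assume u [simp]: "u \<in> carrier U" and v [simp]: "v \<in> carrier U"
  define a b where "a = pull (u \<otimes> (\<tau> u)\<^sup>\<star>)" "b = pull (v \<otimes> (\<tau> v)\<^sup>\<star>)"
  have ia: "i a = u \<otimes> (\<tau> u)\<^sup>\<star>" and ib: "i b = v \<otimes> (\<tau> v)\<^sup>\<star>" and ac [simp]: "a \<in> carrier A" "b \<in> carrier A"
    by (simp_all add: a_b_def)
  \<comment> \<open>The preimage of \<open>a\<close> under \<open>\<theta> (j u)\<close>, found by
    conjugating backwards with the representative \<open>\<tau> u\<close>.\<close>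
  define c where "c = pull ((\<tau> u)\<^sup>\<star> \<otimes> (i a \<otimes> \<tau> u))"
  have "\<tau> u \<otimes> (\<tau> u)\<^sup>\<star> = i a \<otimes> (i a)\<^sup>\<star>"
    unfolding ia \<tau>_quotient_range[OF u] by (simp add: \<tau>_range)
  note P = th_preimage[OF _ \<tau>_quotient_dom[OF u] \<tau>_reps[OF u refl], folded ia, OF _ this]
  have cD: "c \<in> D (inv\<^bsub>G\<^esub> (j u))" and ic: "i c = (\<tau> u)\<^sup>\<star> \<otimes> (i a \<otimes> \<tau> u)"
    unfolding c_def using P(1) pull_D kdomD[OF P(1)] by simp_all
  have "\<theta> (j u) c = a"
    unfolding \<theta>_def ic using P(2) by simp
  then have inv_c: "inv_into (D (inv\<^bsub>G\<^esub> (j u))) (\<theta> (j u)) a = c"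
    using inv_into_f_f[OF _ cD, of "\<theta> (j u)"] \<theta>_bij[of "j u"] unfolding bij_betw_def by simp
  have cb: "c \<otimes>\<^bsub>A\<^esub> b \<in> D (inv\<^bsub>G\<^esub> (j u)) \<inter> D (j v)"
  proof -
    have "b \<in> D (j v)"
      unfolding a_b_def by (rule pull_D[OF \<tau>_quotient_dom[OF v]])
    then show ?thesis
      using D_ideal[of "inv\<^bsub>G\<^esub> (j u)"] D_ideal[of "j v"] cD D_closed[OF cD] unfolding sg_ideal_def by simp
  qed
  have tc: "\<theta> (j u) (c \<otimes>\<^bsub>A\<^esub> b) \<in> D (j u) \<inter> D (j u \<otimes>\<^bsub>G\<^esub> j v)"
    using cb by (subst \<theta>_image[symmetric]) auto
  have "i (snd (w (j u) (j v)) (\<theta> (j u) (c \<otimes>\<^bsub>A\<^esub> b))) = u \<otimes> v \<otimes> (\<tau> (u \<otimes> v))\<^sup>\<star>"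
    using tc cb rmul_th_\<tau>[OF u v] D_closed[OF cD] by (simp add: i_w i_\<theta> ic ia ib)
  moreover have "snd (w (j u) (j v)) (\<theta> (j u) (c \<otimes>\<^bsub>A\<^esub> b)) \<in> carrier A"
    using i_w(3) tc D_closed by (metis IntD1 IntD2 u v j_closed)
  ultimately have "snd (w (j u) (j v)) (\<theta> (j u) (c \<otimes>\<^bsub>A\<^esub> b)) = pull (u \<otimes> v \<otimes> (\<tau> (u \<otimes> v))\<^sup>\<star>)"
    by (metis pull_i)
  then show "\<mu> (u \<otimes> v) = \<mu> u \<otimes>\<^bsub>crossed_product A G D \<theta> w\<^esub> \<mu> v"
    using inv_c by (simp add: \<mu>_def crossed_product_def a_b_def)
qed

lemma \<mu>_i: "a \<in> carrier A \<Longrightarrow> \<mu> (i a) = (a, \<one>\<^bsub>G\<^esub>)"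
proof -
  assume a [simp]: "a \<in> carrier A"
  have "\<tau> (i a) = \<tau> (i a \<otimes> (i a)\<^sup>\<star>)"
    by (rule \<tau>_cong) simp_all
  also have "\<dots> = i a \<otimes> (i a)\<^sup>\<star>"
    by (rule \<tau>_idem) simp
  finally have "i a \<otimes> (\<tau> (i a))\<^sup>\<star> = i a"
    using idem_central[of "i a \<otimes> (i a)\<^sup>\<star>" "i a"] by simp
  then show ?thesis
    by (simp add: \<mu>_def)
qed

lemma crossed_product_equivalent:
  "equivalent_ext A U i j (crossed_product A G D \<theta> w) (\<lambda>a. (a, \<one>\<^bsub>G\<^esub>)) snd"
  unfolding equivalent_ext_def
  using \<mu>_bij \<mu>_hom \<mu>_i by (intro exI[of _ \<mu>]) (simp add: \<mu>_def)

end

section \<open>Extensions up to equivalence, and the use of admissibility\<close>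

lemma group_extension_equivalent:
  assumes ext: "group_extension A U G i j" and "equivalent_ext A U i j V i' j'"
  shows "group_extension A V G i' j'"
proof -
  obtain \<mu> where bij: "bij_betw \<mu> (carrier U) (carrier V)" and hom: "sg_hom U V \<mu>"
    and \<mu>i: "\<And>a. a \<in> carrier A \<Longrightarrow> i' a = \<mu> (i a)" and j\<mu>: "\<And>u. u \<in> carrier U \<Longrightarrow> j' (\<mu> u) = j u"
    using assms(2) unfolding equivalent_ext_def by metis
  have V: "carrier V = \<mu> ` carrier U"
    using bij by (simp add: bij_betw_def)
  have i: "i \<in> carrier A \<rightarrow> carrier U" "inj_on i (carrier A)"
      "\<And>a b. a \<in> carrier A \<Longrightarrow> b \<in> carrier A \<Longrightarrow> i (a \<otimes>\<^bsub>A\<^esub> b) = i a \<otimes>\<^bsub>U\<^esub> i b"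
      "i ` carrier A = {u \<in> carrier U. j u = \<one>\<^bsub>G\<^esub>}" and A: "inverse_semigroup A"
    using ext by (auto simp: group_extension_def sg_mono_def sg_hom_def)
  have U: "sgrp U" "inverse_semigroup U"
    using ext by (auto simp: group_extension_def inverse_semigroup_def)
  have j: "j ` carrier U = carrier G" "\<And>u v. u \<in> carrier U \<Longrightarrow> v \<in> carrier U \<Longrightarrow> j (u \<otimes>\<^bsub>U\<^esub> v) = j u \<otimes>\<^bsub>G\<^esub> j v"
    using ext by (auto simp: group_extension_def sg_epi_def sg_hom_def)
  have m: "\<mu> (u \<otimes>\<^bsub>U\<^esub> v) = \<mu> u \<otimes>\<^bsub>V\<^esub> \<mu> v" if "u \<in> carrier U" "v \<in> carrier U" for u v
    using hom that by (simp add: sg_hom_def)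
  have Ac: "a \<otimes>\<^bsub>A\<^esub> b \<in> carrier A" if "a \<in> carrier A" "b \<in> carrier A" for a b
    using A that by (simp add: inverse_semigroup_def sgrp_def)
  have Uc: "a \<otimes>\<^bsub>U\<^esub> b \<in> carrier U" if "a \<in> carrier U" "b \<in> carrier U" for a b
    using U(1) that by (simp add: sgrp_def)
  have ic: "i a \<in> carrier U" if "a \<in> carrier A" for a
    using i(1) that by blast
  have "inj_on (\<mu> \<circ> i) (carrier A)"
    using i bij by (intro comp_inj_on) (auto simp: bij_betw_def intro: inj_on_subset)
  then have "inj_on i' (carrier A)"
    using \<mu>i by (auto simp: inj_on_def)
  then have mono: "sg_mono A V i'"
    using ic m i(3) Ac unfolding sg_mono_def sg_hom_def by (simp add: \<mu>i V)
  have "j' ` carrier V = carrier G"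
    unfolding V image_image using j(1) j\<mu> by (simp cong: image_cong)
  moreover have "j' (\<mu> u \<otimes>\<^bsub>V\<^esub> \<mu> v) = j' (\<mu> u) \<otimes>\<^bsub>G\<^esub> j' (\<mu> v)" if "u \<in> carrier U" "v \<in> carrier U" for u v
    using that by (simp add: m[symmetric] j\<mu> Uc j(2))
  ultimately have epi: "sg_epi V G j'"
    unfolding sg_epi_def sg_hom_def V by auto
  have "i' ` carrier A = \<mu> ` i ` carrier A"
    using \<mu>i by (auto simp: image_image)
  also have "\<dots> = {v \<in> carrier V. j' v = \<one>\<^bsub>G\<^esub>}"
    unfolding i(4) V using j\<mu> by auto
  finally show ?thesis
    using mono epi inverse_semigroup_iso[OF U(2) bij hom] A ext by (simp add: group_extension_def)
qed

text \<open>All use of order preservation is concentrated here. The image of \<open>A\<close> is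
  described once through \<open>j\<close> and once through \<open>p\<close>, so \<open>p\<close>
  sends the kernel of \<open>j\<close> to idempotents of \<open>S\<close>.\<close>

lemma admissible_kernel_ext:
  assumes A: "semilattice_of_groups A" and adm: "admissible_via A U G i j S p k"
    and \<rho>: "order_preserving_transversal U S p \<rho>"
  shows "kernel_ext U G j (\<lambda>u. \<rho> (p u)) A i"
proof -
  have ext: "group_extension A U G i j" and lau: "lausch_extension A U S i p"
    and jk: "\<And>u. u \<in> carrier U \<Longrightarrow> j u = k (p u)"
    using adm by (auto simp: admissible_via_def)
  have invs: "inverse_semigroup A" "inverse_semigroup U" "inverse_semigroup S" "group G"
    using ext lau by (auto simp: group_extension_def lausch_extension_def)
  interpret inv_sgrp U by (rule inv_sgrp.intro) fact
  interpret S: inv_sgrp S by (rule inv_sgrp.intro) fact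
  interpret G: group G by fact
  have jepi: "sg_epi U G j" and imono: "sg_mono A U i" and im: "i ` carrier A = {u \<in> carrier U. j u = \<one>\<^bsub>G\<^esub>}"
    using ext by (auto simp: group_extension_def)
  have phom: "sg_hom U S p" and im': "i ` carrier A = {u \<in> carrier U. p u \<in> idems S}"
    and sep: "\<And>e f. e \<in> idems U \<Longrightarrow> f \<in> idems U \<Longrightarrow> p e = p f \<Longrightarrow> e = f"
    using lau by (auto simp: lausch_extension_def sg_epi_def idem_separating_def)
  have p [simp]: "p u \<in> carrier S" "v \<in> carrier U \<Longrightarrow> p (u \<otimes>\<^bsub>U\<^esub> v) = p u \<otimes>\<^bsub>S\<^esub> p v" "p (u\<^sup>\<star>) = S.star (p u)"
    if "u \<in> carrier U" for u v
    using phom sg_hom_star[OF invs(2,3) phom] that by (auto simp: sg_hom_def)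
  have ker: "p a \<in> idems S" if "a \<in> carrier U" "j a = \<one>\<^bsub>G\<^esub>" for a
    using im im' that by blast
  have r [simp]: "\<rho> s \<in> carrier U" "p (\<rho> s) = s" if "s \<in> carrier S" for s
    using \<rho> that by (auto simp: order_preserving_transversal_def transversal_def)
  have r_idem: "\<rho> s \<in> idems U" if "s \<in> idems S" for s
    using \<rho> that by (auto simp: order_preserving_transversal_def transversal_def)
  have p_idem: "p e \<in> idems S" if "e \<in> idems U" for e
    using that p(2)[of e e] by (intro S.idemsI) simp_all
  have j_one: "j e = \<one>\<^bsub>G\<^esub>" if "e \<in> idems U" for e
    using that jepi by (metis (no_types, lifting) G.r_cancel_one' PiE idem idems_closed sg_epi_def sg_hom_def)
  have central: "e \<otimes>\<^bsub>U\<^esub> a = a \<otimes>\<^bsub>U\<^esub> e" if e: "e \<in> idems U" and a: "a \<in> carrier U" "j a = \<one>\<^bsub>G\<^esub>" for e a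
  proof -
    obtain f b where f: "f \<in> carrier A" "e = i f" and b: "b \<in> carrier A" "a = i b"
      using im e a j_one[OF e] idems_closed[OF e] by (metis (mono_tags, lifting) image_iff mem_Collect_eq)
    have i: "i (c \<otimes>\<^bsub>A\<^esub> d) = i c \<otimes>\<^bsub>U\<^esub> i d" if "c \<in> carrier A" "d \<in> carrier A" for c d
      using imono that by (simp add: sg_mono_def sg_hom_def)
    have "f \<otimes>\<^bsub>A\<^esub> f \<in> carrier A"
      using invs(1) f by (simp add: inverse_semigroup_def sgrp_def)
    moreover have "i (f \<otimes>\<^bsub>A\<^esub> f) = i f"
      using idem[OF e] f by (simp add: i)
    ultimately have "f \<otimes>\<^bsub>A\<^esub> f = f"
      using imono f(1) by (auto simp: sg_mono_def inj_on_def)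
    then have "f \<otimes>\<^bsub>A\<^esub> b = b \<otimes>\<^bsub>A\<^esub> f"
      using A f(1) b(1) by (simp add: semilattice_of_groups_def idems_def)
    then show ?thesis
      using f b by (metis i)
  qed
  \<comment> \<open>Both sides are idempotents with the same image under \<open>p\<close>.\<close>
  have range: "\<rho> (p u) \<otimes>\<^bsub>U\<^esub> (\<rho> (p u))\<^sup>\<star> = u \<otimes>\<^bsub>U\<^esub> u\<^sup>\<star>" if "u \<in> carrier U" for u
    by (rule sep) (use that in simp_all)
  have mult: "\<rho> (p (a \<otimes>\<^bsub>U\<^esub> u)) = a \<otimes>\<^bsub>U\<^esub> a\<^sup>\<star> \<otimes>\<^bsub>U\<^esub> \<rho> (p u)"
    if a [simp]: "a \<in> carrier U" and u [simp]: "u \<in> carrier U" and ja: "j a = \<one>\<^bsub>G\<^esub>" for a u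
  proof -
    \<comment> \<open>Multiplying by the idempotent \<open>p a\<close> moves down in the natural
      order. Order preservation then gives the transversal value at \<open>p (a u)\<close> as
      \<open>e t\<close>, with an idempotent \<open>e\<close> about which nothing else is known
      yet.\<close>
    have "nat_le S (p (a \<otimes>\<^bsub>U\<^esub> u)) (p u)"
      using ker[OF a ja] by (auto simp: nat_le_def)
    then have "nat_le U (\<rho> (p (a \<otimes>\<^bsub>U\<^esub> u))) (\<rho> (p u))"
      using \<rho> by (simp add: order_preserving_transversal_def del: p(2))
    then obtain e where e [simp]: "e \<in> idems U" and le: "\<rho> (p (a \<otimes>\<^bsub>U\<^esub> u)) = e \<otimes>\<^bsub>U\<^esub> \<rho> (p u)"
      by (auto simp: nat_le_def)
    define t where "t = \<rho> (p u)"
    have [simp]: "t \<in> carrier U" and t: "t \<otimes>\<^bsub>U\<^esub> t\<^sup>\<star> = u \<otimes>\<^bsub>U\<^esub> u\<^sup>\<star>"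
      by (simp_all add: t_def range)
    \<comment> \<open>Comparing ranges determines \<open>e\<close> on the range of \<open>t\<close>:
      there it agrees with \<open>a a\<^sup>\<star>\<close>, which suffices after multiplication by
      \<open>t\<close>.\<close>
    have "t \<otimes>\<^bsub>U\<^esub> (t\<^sup>\<star> \<otimes>\<^bsub>U\<^esub> e) = e \<otimes>\<^bsub>U\<^esub> (t \<otimes>\<^bsub>U\<^esub> t\<^sup>\<star>)"
      using idem_comm[of "t \<otimes>\<^bsub>U\<^esub> t\<^sup>\<star>" e] by simp
    then have "e \<otimes>\<^bsub>U\<^esub> (t \<otimes>\<^bsub>U\<^esub> t\<^sup>\<star>) = (e \<otimes>\<^bsub>U\<^esub> t) \<otimes>\<^bsub>U\<^esub> (e \<otimes>\<^bsub>U\<^esub> t)\<^sup>\<star>"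
      by simp
    also have "\<dots> = (a \<otimes>\<^bsub>U\<^esub> u) \<otimes>\<^bsub>U\<^esub> (a \<otimes>\<^bsub>U\<^esub> u)\<^sup>\<star>"
      using range[of "a \<otimes>\<^bsub>U\<^esub> u"] unfolding le t_def[symmetric] by simp
    also have "\<dots> = a \<otimes>\<^bsub>U\<^esub> ((u \<otimes>\<^bsub>U\<^esub> u\<^sup>\<star>) \<otimes>\<^bsub>U\<^esub> a\<^sup>\<star>)"
      by simp
    also have "(u \<otimes>\<^bsub>U\<^esub> u\<^sup>\<star>) \<otimes>\<^bsub>U\<^esub> a\<^sup>\<star> = a\<^sup>\<star> \<otimes>\<^bsub>U\<^esub> (u \<otimes>\<^bsub>U\<^esub> u\<^sup>\<star>)"
    proof -
      have "(u \<otimes>\<^bsub>U\<^esub> u\<^sup>\<star>) \<otimes>\<^bsub>U\<^esub> a = a \<otimes>\<^bsub>U\<^esub> (u \<otimes>\<^bsub>U\<^esub> u\<^sup>\<star>)"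
        by (rule central) (use ja in simp_all)
      from arg_cong[OF this, of "sg_inv U"] show ?thesis
        by simp
    qed
    finally have *: "e \<otimes>\<^bsub>U\<^esub> (t \<otimes>\<^bsub>U\<^esub> t\<^sup>\<star>) = a \<otimes>\<^bsub>U\<^esub> (a\<^sup>\<star> \<otimes>\<^bsub>U\<^esub> (t \<otimes>\<^bsub>U\<^esub> t\<^sup>\<star>))"
      by (simp add: t)
    have "e \<otimes>\<^bsub>U\<^esub> t = a \<otimes>\<^bsub>U\<^esub> (a\<^sup>\<star> \<otimes>\<^bsub>U\<^esub> t)"
      using arg_cong[OF *, of "\<lambda>v. v \<otimes>\<^bsub>U\<^esub> t"] by simp
    then show ?thesis
      unfolding le by (simp add: t_def)
  qed
  \<comment> \<open>A transversal sends idempotents to idempotents, so \<open>\<rho> (p e)\<close>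
    and \<open>e\<close> are idempotents with the same image under \<open>p\<close>.\<close>
  have \<tau>_idem: "\<rho> (p e) = e" if "e \<in> idems U" for e
    by (rule sep) (use that p_idem[OF that] r_idem in simp_all)
  show ?thesis
    by unfold_locales
      (use jepi central range mult \<tau>_idem imono im invs(1) in \<open>simp_all add: jk\<close>)
qed

theorem theorem6p12:
  fixes A :: "'a monoid" and U :: "'u monoid" and G :: "'g monoid" and S :: "'s monoid"
    and i :: "'a \<Rightarrow> 'u" and j :: "'u \<Rightarrow> 'g" and p :: "'u \<Rightarrow> 's" and k :: "'s \<Rightarrow> 'g"
  assumes "semilattice_of_groups A"
    and "group G"
    and "admissible_via A U G i j S p k"
  shows "\<exists>D \<theta> w. twisted_partial_action G A D \<theta> w \<and>
           group_extension A (crossed_product A G D \<theta> w) G (\<lambda>a. (a, \<one>\<^bsub>G\<^esub>)) snd \<and>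
           equivalent_ext A U i j (crossed_product A G D \<theta> w) (\<lambda>a. (a, \<one>\<^bsub>G\<^esub>)) snd"
proof -
  obtain \<rho> where "order_preserving_transversal U S p \<rho>"
    using assms(3) unfolding admissible_via_def by blast
  then interpret kernel_ext U G j "\<lambda>u. \<rho> (p u)" A i
    by (rule admissible_kernel_ext[OF assms(1,3)])
  have "group_extension A U G i j"
    using assms(3) by (simp add: admissible_via_def)
  then show ?thesis
    using twisted_partial_action crossed_product_equivalent group_extension_equivalent by blast
qed

end
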